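(* Let $\delta < 0.01$ be a positive real number and let $c_1,c_2$ be positive constants. For large real $X$, let $\mathcal{B}$ be a box in $V(\mathbb{R})$ defined by $|b_{ij}|\leq X_{ij}$ for $(i,j)\in\{(1,1),(1,2),(1,3),(1,4),(2,2),(2,4),(3,3),(3,4),(4,4)\}$, where the $X_{ij}$ are real numbers satisfying $c_1^{-1}X^{1-2\delta}\leq X_{ij}\leq c_1X^{1+2\delta}$, $X_{14}=c_2 X$, and $$X_{11} X_{44} = X_{22} X_{33} = X_{12} X_{34} = X_{13} X_{24} = c_2^2 X^2.$$ Let $N^{\mathrm{dist}}_q(\mathcal{B})$ be the number of $B\in \mathcal{B}\cap V(\mathbb{Z})$ with $q(B)=0$, $\Delta(B)\neq 0$, and $B$ $\mathbb{Q}$-distinguished. Then for every $\epsilon>0$, $$N_q^{\mathrm{dist}}(\mathcal{B}) = O_\epsilon\left(X^{\frac{209}{30} + \frac{137}{45}\delta + \epsilon}\right),$$ with implied constant independent of $X$ and of the particular $X_{ij}$.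
   Context: $V$ is the $9$-dimensional space of symmetric $4\times4$ matrices $B=(b_{ij})$ satisfying $b_{23}=-b_{14}$, with coordinates $b_{11},b_{12},b_{13},b_{14},b_{22},b_{24},b_{33},b_{34},b_{44}$; $V(\mathbb{Z})$, $V(\mathbb{R})$ denote its integer and real points. The quadratic form $q$ on $V$ is $q(B) = -b_{11}b_{44} - b_{22}b_{33} - 2b_{12}b_{34} - 2b_{13}b_{24} - 2b_{14}^2$. Let $A_0$ be the $4\times 4$ matrix with $1$'s on the anti-diagonal and $0$'s elsewhere; $\Delta(B)$ is the discriminant of $f_B(x)=\det(A_0x-B)$. An element $B$ with $\Delta(B)\ne0$ is $\mathbb{Q}$-distinguished if there exist linearly independent $v,w\in\mathbb{Q}^4$ with $v^tA_0v = v^tBv = w^tA_0w = v^tA_0w = v^tBw = 0$. *)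

theory Defs
  imports "Subresultants.Resultant_Prelim" "HOL-Analysis.Analysis"
begin

(* The resultant comes with the matrix library of Jordan_Normal_Form, whose infix $ would make
   the indexing of Finite_Cartesian_Product.vec ambiguous. *)
no_notation Matrix.vec_index (infixl \<open>$\<close> 100)
hide_const (open) Matrix.transpose_mat Determinant.det

(* The R-points of V for a ring R; the index 4 of type 4 is also written 0. *)
definition Vspace :: "('a::comm_ring_1 ^ 4 ^ 4) set"
  where "Vspace = {B. transpose B = B \<and> B $ 2 $ 3 = - (B $ 1 $ 4)}"

definition coords :: "(4 \<times> 4) set"
  where "coords = {(1,1), (1,2), (1,3), (1,4), (2,2), (2,4), (3,3), (3,4), (4,4)}"

definition qform :: "'a::comm_ring_1 ^ 4 ^ 4 \<Rightarrow> 'a"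
  where "qform B = - (B $ 1 $ 1 * B $ 4 $ 4) - B $ 2 $ 2 * B $ 3 $ 3 - 2 * B $ 1 $ 2 * B $ 3 $ 4
                 - 2 * B $ 1 $ 3 * B $ 2 $ 4 - 2 * (B $ 1 $ 4)\<^sup>2"

definition A0 :: "'a::comm_ring_1 ^ 4 ^ 4"
  where "A0 = vector [vector [0, 0, 0, 1],
                      vector [0, 0, 1, 0],
                      vector [0, 1, 0, 0],
                      vector [1, 0, 0, 0]]"

(* det (A0 x - B), the determinant being taken over the polynomial ring in x *)
definition inv_poly :: "'a::comm_ring_1 ^ 4 ^ 4 \<Rightarrow> 'a poly"
  where "inv_poly B = Determinants.det (\<chi> i j. [: - (B $ i $ j), A0 $ i $ j :])"

(* The division by the leading coefficient is exact. *)
definition poly_discriminant :: "'a::idom_divide poly \<Rightarrow> 'a"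
  where "poly_discriminant p =
    (- 1) ^ (degree p * (degree p - 1) div 2) * (resultant p (pderiv p) div lead_coeff p)"

definition Delta :: "'a::idom_divide ^ 4 ^ 4 \<Rightarrow> 'a"
  where "Delta B = poly_discriminant (inv_poly B)"

definition bilin :: "'a::comm_ring_1 ^ 4 ^ 4 \<Rightarrow> 'a ^ 4 \<Rightarrow> 'a ^ 4 \<Rightarrow> 'a"
  where "bilin M v w = (\<Sum>i\<in>UNIV. \<Sum>j\<in>UNIV. v $ i * M $ i $ j * w $ j)"

(* Only used for Delta B \<noteq> 0.  The condition v \<noteq> w makes independence of the set {v, w} the
   independence of the pair. *)
definition Q_distinguished :: "rat ^ 4 ^ 4 \<Rightarrow> bool"
  where "Q_distinguished B \<longleftrightarrow>
    (\<exists>v w. v \<noteq> w \<and> vec.independent {v, w} \<and>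
       bilin A0 v v = 0 \<and> bilin B v v = 0 \<and> bilin A0 w w = 0 \<and>
       bilin A0 v w = 0 \<and> bilin B v w = 0)"

(* Only the values Y i j with (i, j) in coords matter. *)
definition coord_box :: "(4 \<Rightarrow> 4 \<Rightarrow> real) \<Rightarrow> (real ^ 4 ^ 4) set"
  where "coord_box Y = {B \<in> Vspace. \<forall>(i, j) \<in> coords. \<bar>B $ i $ j\<bar> \<le> Y i j}"

definition N_q_dist :: "(real ^ 4 ^ 4) set \<Rightarrow> nat"
  where "N_q_dist S = card {B :: int ^ 4 ^ 4. B \<in> Vspace \<and> map_matrix real_of_int B \<in> S \<and>
    qform B = 0 \<and> Delta B \<noteq> 0 \<and> Q_distinguished (map_matrix rat_of_int B)}"

definition admissible :: "real \<Rightarrow> real \<Rightarrow> real \<Rightarrow> real \<Rightarrow> (4 \<Rightarrow> 4 \<Rightarrow> real) \<Rightarrow> bool"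
  where "admissible \<delta> c1 c2 X Y \<longleftrightarrow>
    (\<forall>(i, j) \<in> coords. inverse c1 * X powr (1 - 2 * \<delta>) \<le> Y i j \<and>
                       Y i j \<le> c1 * X powr (1 + 2 * \<delta>)) \<and>
    Y 1 4 = c2 * X \<and>
    Y 1 1 * Y 4 4 = c2\<^sup>2 * X\<^sup>2 \<and> Y 2 2 * Y 3 3 = c2\<^sup>2 * X\<^sup>2 \<and>
    Y 1 2 * Y 3 4 = c2\<^sup>2 * X\<^sup>2 \<and> Y 1 3 * Y 2 4 = c2\<^sup>2 * X\<^sup>2"

end

theory Submission
  imports Defs
begin

text \<open>
  Isotropic vectors of \<open>A\<^sub>0\<close> are \<open>x \<otimes> y = (x\<^sub>0y\<^sub>0, x\<^sub>0y\<^sub>1, x\<^sub>1y\<^sub>0, -x\<^sub>1y\<^sub>1)\<close>, so \<open>B\<close> is a \<open>(2,2)\<close>-form in \<open>x\<close> and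
  \<open>y\<close>, and \<open>B\<close> is distinguished only if one of its two discriminant quartics has a rational root
  \<open>(r : s)\<close>. Fix the six coordinates away from \<open>(b\<^sub>1\<^sub>3, b\<^sub>1\<^sub>4, b\<^sub>2\<^sub>4)\<close> (or from \<open>(b\<^sub>1\<^sub>2, b\<^sub>1\<^sub>4, b\<^sub>3\<^sub>4)\<close>). They determine
  the outer coefficients of the quartic, which \<open>s\<close> and \<open>r\<close> divide, so by the divisor bound
  few \<open>(r : s)\<close> are possible. For each of them \<open>q(B) = 0\<close> puts the three remaining coordinates on a
  quadric and turns the root condition into a linear equation. The resulting conic carries
  \<open>O(n\<^bsup>2/3\<^esup>)\<close> integer points of size at most \<open>n\<close> unless it degenerates, and degenerate conics are rare
  enough for the trivial bound. With \<open>n\<close> of order \<open>X\<^bsup>1+2\<delta>\<^esup>\<close> the total \<open>O(n\<^bsup>20/3+\<epsilon>\<^esup>)\<close> suffices.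
\<close>

section \<open>The divisor bound\<close>

lemma card_divisors_le:
  fixes p e m :: nat
  assumes "prime p" "m > 0"
  shows "card {d. d dvd p ^ e * m} \<le> (e + 1) * card {d. d dvd m}"
proof -
  have "{d. d dvd p ^ e * m} \<subseteq> (\<lambda>(i, d). p ^ i * d) ` ({0..e} \<times> {d. d dvd m})"
  proof
    fix d assume "d \<in> {d. d dvd p ^ e * m}"
    then obtain b c where bc: "d = b * c" "b dvd p ^ e" "c dvd m"
      using division_decomp[of d "p ^ e" m] by auto
    then obtain i where "i \<le> e" "b = p ^ i"
      using divides_primepow_nat[OF assms(1)] by auto
    with bc show "d \<in> (\<lambda>(i, d). p ^ i * d) ` ({0..e} \<times> {d. d dvd m})"
      by auto
  qed
  moreover have fin: "finite ({0..e} \<times> {d. d dvd m})"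
    using assms(2) by simp
  ultimately have "card {d. d dvd p ^ e * m} \<le> card ({0..e} \<times> {d. d dvd m})"
    using surj_card_le by blast
  then show ?thesis by (simp add: card_cartesian_product)
qed

text \<open>A prime power \<open>p ^ e\<close> in \<open>n\<close> contributes the factor
  \<open>e + 1\<close> to the number of divisors, and \<open>n powr \<epsilon>\<close> absorbs it
  once \<open>p powr \<epsilon> \<ge> 2\<close>. The primes below this threshold are bounded in
  number, and each costs at most a constant factor \<open>K\<close>.\<close>

theorem divisor_bound_nat:
  fixes \<epsilon> :: real
  assumes "\<epsilon> > 0"
  obtains C where "C \<ge> 1" "\<And>n::nat. n > 0 \<Longrightarrow> real (card {d. d dvd n}) \<le> C * real n powr \<epsilon>"
proof -
  define P where "P = nat \<lceil>2 powr (1 / \<epsilon>)\<rceil>"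
  \<comment> \<open>This makes \<open>1 + e \<le> K * (1 + \<epsilon> * ln 2 * e)\<close>, and the
    bracket is at most \<open>(2 powr \<epsilon>) ^ e\<close> by the exponential inequality.\<close>
  define K where "K = max 1 (1 / (\<epsilon> * ln 2))"
  define small where "small n = {p. prime p \<and> p dvd n \<and> p < P}" for n :: nat
  have K1: "K \<ge> 1" by (simp add: K_def)
  have small_fin: "finite (small n)" "card (small n) \<le> P" for n
  proof -
    have "small n \<subseteq> {..<P}" by (auto simp: small_def)
    then show "finite (small n)" "card (small n) \<le> P"
      using finite_subset[of "small n" "{..<P}"] card_mono[of "{..<P}" "small n"] by simp_all
  qed
  have expand: "real (p ^ e) powr \<epsilon> = (real p powr \<epsilon>) ^ e" if "p > 0" for p e :: nat
    using that by (simp add: powr_realpow[symmetric] powr_powr mult.commute)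
  have any: "real (e + 1) \<le> K * real (p ^ e) powr \<epsilon>" if "prime p" for p e :: nat
  proof -
    have p2: "p \<ge> 2" using that by (rule prime_ge_2_nat)
    have "1 + \<epsilon> * ln 2 * real e \<le> exp (\<epsilon> * ln 2 * real e)"
      by (rule exp_ge_add_one_self)
    also have "\<dots> = (2 powr \<epsilon>) ^ e"
      by (simp add: powr_def exp_of_nat_mult[symmetric] mult_ac)
    also have "\<dots> \<le> (real p powr \<epsilon>) ^ e"
      using p2 assms by (intro power_mono powr_mono2) auto
    finally have le: "1 + \<epsilon> * ln 2 * real e \<le> real (p ^ e) powr \<epsilon>"
      using expand p2 by simp
    have pos: "\<epsilon> * ln 2 > 0" using assms by simp
    have "1 \<le> K * (\<epsilon> * ln 2)"
      using pos assms unfolding K_def by (simp add: field_simps max_def)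
    then have "real e * 1 \<le> real e * (K * (\<epsilon> * ln 2))"
      by (intro mult_left_mono) auto
    then have "real (e + 1) \<le> K * (1 + \<epsilon> * ln 2 * real e)"
      using K1 by (simp add: algebra_simps)
    also have "\<dots> \<le> K * real (p ^ e) powr \<epsilon>"
      using le K1 by (intro mult_left_mono) auto
    finally show ?thesis .
  qed
  have large: "real (e + 1) \<le> real (p ^ e) powr \<epsilon>" if "prime p" "p \<ge> P" for p e :: nat
  proof -
    have "2 powr (1 / \<epsilon>) \<le> real p"
      using that(2) unfolding P_def by linarith
    then have "(2 powr (1 / \<epsilon>)) powr \<epsilon> \<le> real p powr \<epsilon>"
      using assms by (intro powr_mono2) auto
    then have "2 \<le> real p powr \<epsilon>" using assms by (simp add: powr_powr)
    then have "2 ^ e \<le> (real p powr \<epsilon>) ^ e" by (intro power_mono) auto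
    moreover have "real (e + 1) \<le> 2 ^ e"
      using of_nat_mono[OF less_exp[of e, THEN Suc_leI], where 'a = real] by simp
    ultimately show ?thesis using expand prime_gt_0_nat[OF that(1)] by simp
  qed
  \<comment> \<open>The induction strips the full power of one prime from \<open>n\<close>; the
    exponent of \<open>K\<close> counts the small primes dividing \<open>n\<close>.\<close>
  have main: "real (card {d. d dvd n}) \<le> K ^ card (small n) * real n powr \<epsilon>" if "n > 0" for n
    using that
  proof (induction n rule: less_induct)
    case (less n)
    show ?case
    proof (cases "n = 1")
      case True
      then show ?thesis using K1 by simp
    next
      case False
      then obtain p where p: "prime p" "p dvd n" using prime_factor_nat by blast
      obtain m where m: "n = p ^ multiplicity p n * m" "\<not> p dvd m"
        using multiplicity_decompose'[of n p] less.prems p prime_gt_1_nat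
        by (metis not_gr_zero not_prime_unit)
      define e where "e = multiplicity p n"
      have e: "e > 0" using p less.prems by (simp add: e_def prime_multiplicity_gt_zero_iff)
      have m0: "m > 0" using m less.prems by (cases m) auto
      have n_eq: "n = p ^ e * m" using m e_def by simp
      have "p ^ e > 1" using e p prime_gt_1_nat by (metis one_less_power)
      then have "m < n" using n_eq m0 by simp
      then have IH: "real (card {d. d dvd m}) \<le> K ^ card (small m) * real m powr \<epsilon>"
        using less.IH m0 by blast
      have split: "real n powr \<epsilon> = real (p ^ e) powr \<epsilon> * real m powr \<epsilon>"
        unfolding n_eq by (simp add: powr_mult)
      have sub: "small m \<subseteq> small n" unfolding small_def n_eq by auto
      \<comment> \<open>Since \<open>p\<close> does not divide \<open>m\<close>, a small
        \<open>p\<close> is new and pays for one more factor \<open>K\<close>; a large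
        \<open>p\<close> costs nothing.\<close>
      have step: "real (e + 1) * K ^ card (small m) \<le> K ^ card (small n) * real (p ^ e) powr \<epsilon>"
      proof (cases "p < P")
        case True
        then have "insert p (small m) \<subseteq> small n" using sub p by (auto simp: small_def)
        moreover have "p \<notin> small m" using m by (auto simp: small_def)
        ultimately have "Suc (card (small m)) \<le> card (small n)"
          using small_fin card_mono by (metis card_insert_disjoint)
        then have "K ^ Suc (card (small m)) \<le> K ^ card (small n)"
          using K1 by (rule power_increasing)
        then have "K ^ Suc (card (small m)) * real (p ^ e) powr \<epsilon> \<le> K ^ card (small n) * real (p ^ e) powr \<epsilon>"
          by (rule mult_right_mono) auto
        moreover have "real (e + 1) * K ^ card (small m) \<le> (K * real (p ^ e) powr \<epsilon>) * K ^ card (small m)"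
          using any[OF p(1)] K1 by (intro mult_right_mono) auto
        ultimately show ?thesis by (simp add: mult_ac)
      next
        case False
        have "K ^ card (small m) \<le> K ^ card (small n)"
          using K1 sub small_fin by (intro power_increasing card_mono)
        then have "real (e + 1) * K ^ card (small m) \<le> real (p ^ e) powr \<epsilon> * K ^ card (small n)"
          using large[OF p(1), of e] False K1 by (intro mult_mono) auto
        then show ?thesis by (simp add: mult_ac)
      qed
      have "real (card {d. d dvd n}) \<le> real ((e + 1) * card {d. d dvd m})"
        unfolding n_eq using card_divisors_le[OF p(1) m0] of_nat_le_iff by blast
      also have "\<dots> \<le> real (e + 1) * (K ^ card (small m) * real m powr \<epsilon>)"
        using IH by (simp only: of_nat_mult mult_left_mono of_nat_0_le_iff)
      also have "\<dots> = (real (e + 1) * K ^ card (small m)) * real m powr \<epsilon>" by simp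
      also have "\<dots> \<le> (K ^ card (small n) * real (p ^ e) powr \<epsilon>) * real m powr \<epsilon>"
        using step by (rule mult_right_mono) auto
      finally show ?thesis unfolding split by (simp add: mult_ac)
    qed
  qed
  show ?thesis
  proof (rule that)
    show "K ^ P \<ge> 1" using K1 by simp
    show "real (card {d. d dvd n}) \<le> K ^ P * real n powr \<epsilon>" if "n > 0" for n
    proof -
      have "K ^ card (small n) \<le> K ^ P" using K1 small_fin by (intro power_increasing)
      then have "K ^ card (small n) * real n powr \<epsilon> \<le> K ^ P * real n powr \<epsilon>"
        by (rule mult_right_mono) auto
      then show ?thesis using main[OF that] by linarith
    qed
  qed
qed

lemma divisor_bound_int:
  fixes \<epsilon> :: real
  assumes "\<epsilon> > 0"
  obtains C where "C \<ge> 1"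
    "\<And>a::int. a \<noteq> 0 \<Longrightarrow> real (card {d. d dvd a}) \<le> C * \<bar>real_of_int a\<bar> powr \<epsilon>"
proof -
  obtain C where C: "C \<ge> 1" "\<And>n::nat. n > 0 \<Longrightarrow> real (card {d. d dvd n}) \<le> C * real n powr \<epsilon>"
    using divisor_bound_nat[OF assms] by metis
  show ?thesis
  proof (rule that)
    \<comment> \<open>The factor 2 accounts for the negative divisors.\<close>
    show "2 * C \<ge> 1" using C by simp
    fix a :: int assume a: "a \<noteq> 0"
    let ?D = "{d. d dvd nat \<bar>a\<bar>}"
    have fin: "finite ?D" by (rule finite_divisors_nat) (use a in simp)
    have "{d. d dvd a} \<subseteq> int ` ?D \<union> (\<lambda>d. - int d) ` ?D"
    proof
      fix d assume "d \<in> {d. d dvd a}"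
      then have "nat \<bar>d\<bar> \<in> ?D" by (simp add: nat_abs_dvd_iff)
      moreover have "d = int (nat \<bar>d\<bar>) \<or> d = - int (nat \<bar>d\<bar>)" by linarith
      ultimately show "d \<in> int ` ?D \<union> (\<lambda>d. - int d) ` ?D" by blast
    qed
    then have "card {d. d dvd a} \<le> card (int ` ?D \<union> (\<lambda>d. - int d) ` ?D)"
      using fin by (intro card_mono) auto
    also have "\<dots> \<le> card (int ` ?D) + card ((\<lambda>d. - int d) ` ?D)" by (rule card_Un_le)
    also have "\<dots> \<le> card ?D + card ?D" using fin by (intro add_mono card_image_le)
    finally have "real (card {d. d dvd a}) \<le> 2 * real (card ?D)" by linarith
    also have "\<dots> \<le> 2 * (C * real (nat \<bar>a\<bar>) powr \<epsilon>)" using C(2)[of "nat \<bar>a\<bar>"] a by simp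
    finally show "real (card {d. d dvd a}) \<le> 2 * C * \<bar>real_of_int a\<bar> powr \<epsilon>" by simp
  qed
qed

section \<open>Integer points on conics\<close>

abbreviation symm_ints :: "nat \<Rightarrow> int set"
  where "symm_ints n \<equiv> {- int n..int n}"

lemma card_le_2I:
  assumes "finite X" "\<And>x y z. \<lbrakk>x \<in> X; y \<in> X; z \<in> X; x \<noteq> y; y \<noteq> z; x \<noteq> z\<rbrakk> \<Longrightarrow> False"
  shows "card X \<le> 2"
proof (rule ccontr)
  assume "\<not> card X \<le> 2"
  then have "3 \<le> card X" by simp
  then obtain T where "T \<subseteq> X" "card T = 3" by (rule obtain_subset_with_card_n)
  then show False using assms(2) by (auto simp: card_3_iff)
qed

text \<open>
  A monotone chain meets few cells of a grid of mesh \<open>L\<close>, because the cells are told apart by the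
  signed sum of their indices; two points in one cell differ by one of few vectors.
\<close>
lemma card_chain_le:
  fixes S :: "(int \<times> int) set" and L n :: nat and \<sigma> :: int
  assumes L: "L > 0" and \<sigma>: "\<sigma> = 1 \<or> \<sigma> = -1"
    and S: "S \<subseteq> symm_ints n \<times> symm_ints n"
    and chain: "\<And>w t w' t'. (w, t) \<in> S \<Longrightarrow> (w', t') \<in> S \<Longrightarrow> 0 \<le> \<sigma> * ((w' - w) * (t' - t))"
    and fibre: "\<And>d. d \<noteq> 0 \<Longrightarrow> card {P \<in> S. P - d \<in> S} \<le> 2"
  shows "card S \<le> 4 * (n div L) + 5 + 8 * L\<^sup>2"
proof -
  \<comment> \<open>Along the chain \<open>w div int L\<close> and
    \<open>\<sigma> * (t div int L)\<close> move in the same direction, so two points with the same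
    sum share both cell indices.\<close>
  define h where "h = (\<lambda>(w, t). w div int L + \<sigma> * (t div int L))"
  have mono: "a div int L \<le> b div int L" if "a \<le> b" for a b
    using that L by (intro zdiv_mono1) auto
  have cell_less: "w div int L = w' div int L \<and> t div int L = t' div int L"
    if "(w, t) \<in> S" "(w', t') \<in> S" "h (w, t) = h (w', t')" "w < w'" for w t w' t'
  proof -
    have "0 \<le> (w' - w) * (\<sigma> * (t' - t))" using chain[OF that(1,2)] by (simp add: mult_ac)
    then have "0 \<le> \<sigma> * (t' - t)" using that(4) by (simp add: zero_le_mult_iff)
    moreover have "w div int L \<le> w' div int L" using mono that(4) by simp
    ultimately show ?thesis
      using \<sigma> that(3) mono[of t t'] mono[of t' t] by (auto simp: h_def)
  qed
  have cell: "w div int L = w' div int L \<and> t div int L = t' div int L"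
    if "(w, t) \<in> S" "(w', t') \<in> S" "h (w, t) = h (w', t')" for w t w' t'
  proof (cases w w' rule: linorder_cases)
    case less
    then show ?thesis using cell_less that by simp
  next
    case equal
    then show ?thesis using that(3) \<sigma> by (auto simp: h_def)
  next
    case greater
    then show ?thesis using cell_less[OF that(2,1)] that(3) by simp
  qed
  have finS: "finite S" using S by (rule finite_subset) simp
  define R where "R = 2 * (n div L + 1)"
  have ndiv: "int n div int L = int (n div L)" by (simp add: zdiv_int)
  have neg: "- int (n div L) - 1 \<le> - int n div int L"
    using L ndiv by (simp add: zdiv_zminus1_eq_if)
  have absdiv: "- int (n div L) - 1 \<le> x div int L \<and> x div int L \<le> int (n div L)"
    if "x \<in> symm_ints n" for x
    using mono[of x "int n"] mono[of "- int n" x] that neg ndiv by auto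
  have hS: "h ` S \<subseteq> {- int R..int R}"
  proof
    fix v assume "v \<in> h ` S"
    then obtain w t where wt: "(w, t) \<in> S" "v = h (w, t)" by auto
    then have "w \<in> symm_ints n" "t \<in> symm_ints n" using S by auto
    then show "v \<in> {- int R..int R}"
      using absdiv[of w] absdiv[of t] \<sigma> wt(2) by (auto simp: h_def R_def)
  qed
  have card_h: "card (h ` S) \<le> 4 * (n div L) + 5"
  proof -
    have "card (h ` S) \<le> card {- int R..int R}" using hS by (intro card_mono) auto
    then show ?thesis by (simp add: R_def)
  qed
  \<comment> \<open>Each cell gets one representative. Any other point of the cell differs from it
    by a nonzero vector with entries below \<open>L\<close> in absolute value, and
    \<open>fibre\<close> allows each such vector at most two points.\<close>
  define rep where "rep v = (SOME P. P \<in> S \<and> h P = v)" for v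
  have rep: "rep (h P) \<in> S" "h (rep (h P)) = h P" if "P \<in> S" for P
    using someI[of "\<lambda>Q. Q \<in> S \<and> h Q = h P" P] that unfolding rep_def by auto
  define \<Delta> where "\<Delta> = {- int L<..<int L} \<times> {- int L<..<int L}"
  have diff: "P - rep (h P) \<in> \<Delta>" if "P \<in> S" for P
  proof -
    have near: "\<bar>x - y\<bar> < int L" if "x div int L = y div int L" for x y
    proof -
      have "x - y = x mod int L - y mod int L"
        using that by (metis add_diff_cancel_left mult_div_mod_eq)
      then show ?thesis using L pos_mod_bound[of "int L" x] pos_mod_bound[of "int L" y]
          pos_mod_sign[of "int L" x] pos_mod_sign[of "int L" y] by linarith
    qed
    obtain w t w' t' where e: "P = (w, t)" "rep (h P) = (w', t')" by (metis surj_pair)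
    then have "w div int L = w' div int L \<and> t div int L = t' div int L"
      using cell[of w t w' t'] rep[OF that] that by metis
    then have "\<bar>w - w'\<bar> < int L" "\<bar>t - t'\<bar> < int L" using near by auto
    then show ?thesis using e by (auto simp: \<Delta>_def)
  qed
  have "S \<subseteq> {P \<in> S. P = rep (h P)} \<union> (\<Union>d\<in>\<Delta> - {0}. {P \<in> S. P - d \<in> S})"
  proof
    fix P assume P: "P \<in> S"
    show "P \<in> {P \<in> S. P = rep (h P)} \<union> (\<Union>d\<in>\<Delta> - {0}. {P \<in> S. P - d \<in> S})"
    proof (cases "P = rep (h P)")
      case False
      have "P - (P - rep (h P)) \<in> S" using rep[OF P] by simp
      moreover have "P - rep (h P) \<in> \<Delta> - {0}" using False diff[OF P] by simp
      ultimately show ?thesis using P by blast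
    qed (use P in simp)
  qed
  then have "card S \<le> card ({P \<in> S. P = rep (h P)} \<union> (\<Union>d\<in>\<Delta> - {0}. {P \<in> S. P - d \<in> S}))"
    using finS by (intro card_mono) (auto simp: \<Delta>_def)
  also have "\<dots> \<le> card {P \<in> S. P = rep (h P)} + card (\<Union>d\<in>\<Delta> - {0}. {P \<in> S. P - d \<in> S})"
    by (rule card_Un_le)
  also have "card {P \<in> S. P = rep (h P)} \<le> card (rep ` (h ` S))"
    using finS by (intro card_mono) auto
  also have "\<dots> \<le> card (h ` S)" using finS by (intro card_image_le) auto
  also have "card (\<Union>d\<in>\<Delta> - {0}. {P \<in> S. P - d \<in> S}) \<le> (\<Sum>d\<in>\<Delta> - {0}. card {P \<in> S. P - d \<in> S})"
    by (rule card_UN_le) (simp add: \<Delta>_def)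
  also have "\<dots> \<le> (\<Sum>d\<in>\<Delta> - {0}. 2)" using fibre by (intro sum_mono) auto
  also have "\<dots> \<le> 2 * card \<Delta>"
    using card_mono[of \<Delta> "\<Delta> - {0}"] by (simp add: \<Delta>_def)
  also have "card \<Delta> \<le> (2 * L) * (2 * L)"
    unfolding \<Delta>_def card_cartesian_product by (intro mult_le_mono) auto
  finally show ?thesis using card_h by (simp add: power2_eq_square)
qed

section \<open>Smooth plane conics\<close>

lemma quadratic_three_roots:
  fixes a b c x y z :: "'a::idom"
  assumes "a * x\<^sup>2 + b * x + c = 0" "a * y\<^sup>2 + b * y + c = 0" "a * z\<^sup>2 + b * z + c = 0"
    and "x \<noteq> y" "y \<noteq> z" "x \<noteq> z"
  shows "a = 0" "b = 0" "c = 0"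
proof -
  have "(x - y) * (a * (x + y) + b) = 0" using assms(1,2) by Groebner_Basis.algebra
  then have 1: "a * (x + y) + b = 0" using assms(4) by simp
  have "(x - z) * (a * (x + z) + b) = 0" using assms(1,3) by Groebner_Basis.algebra
  then have 2: "a * (x + z) + b = 0" using assms(6) by simp
  have "a * (y - z) = 0" using 1 2 by Groebner_Basis.algebra
  then show a: "a = 0" using assms(5) by simp
  with 1 show "b = 0" by simp
  with a assms(1) show "c = 0" by simp
qed

text \<open>Eliminating \<open>p\<close> from \<open>A * p + B * t + C * w = k\<close> and
  \<open>p * w + t ^ 2 = m\<close> gives the conic \<open>G w t = 0\<close>, which is
  \<open>A\<close> times the second equation. Its determinant is \<open>A / 4\<close> times
  \<open>m * (B ^ 2 + 4 * A * C) - k ^ 2\<close>, so the assumptions say that the conic is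
  smooth.\<close>

locale plane_conic =
  fixes A B C k m :: int
  assumes A: "A \<noteq> 0" and nondeg: "m * (B\<^sup>2 + 4 * A * C) \<noteq> k\<^sup>2"
begin

definition G :: "int \<Rightarrow> int \<Rightarrow> int"
  where "G w t = A * t\<^sup>2 - B * t * w - C * w\<^sup>2 + k * w - A * m"

text \<open>\<open>Gw\<close> and \<open>Gt\<close> are the partial derivatives of
  \<open>G\<close>.\<close>

definition Gw :: "int \<Rightarrow> int \<Rightarrow> int"
  where "Gw w t = - (B * t) - 2 * C * w + k"

definition Gt :: "int \<Rightarrow> int \<Rightarrow> int"
  where "Gt w t = 2 * A * t - B * w"

lemma G_diff:
  "2 * (G w' t' - G w t) = (Gw w t + Gw w' t') * (w' - w) + (Gt w t + Gt w' t') * (t' - t)"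
  unfolding G_def Gw_def Gt_def by Groebner_Basis.algebra

text \<open>A point of the conic with vanishing gradient is singular; eliminating \<open>w\<close>
  and \<open>t\<close> makes the determinant vanish.\<close>

lemma smooth:
  assumes "G w t = 0"
  shows "Gw w t \<noteq> 0 \<or> Gt w t \<noteq> 0"
proof (rule ccontr)
  assume "\<not> ?thesis"
  then have "A * (k\<^sup>2 - m * (B\<^sup>2 + 4 * A * C)) = 0"
    using assms unfolding G_def Gw_def Gt_def by Groebner_Basis.algebra
  then show False using A nondeg by simp
qed

text \<open>On a line \<open>G\<close> becomes a quadratic in one variable, and three roots make all
  its coefficients vanish. This contradicts \<open>A \<noteq> 0\<close> if the line is vertical and
  \<open>nondeg\<close> otherwise.\<close>

lemma no_three_collinear:
  assumes P: "G w1 t1 = 0" "G w2 t2 = 0" "G w3 t3 = 0"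
    and dist: "(w1, t1) \<noteq> (w2, t2)" "(w2, t2) \<noteq> (w3, t3)" "(w1, t1) \<noteq> (w3, t3)"
    and line: "a * w1 + b * t1 = c" "a * w2 + b * t2 = c" "a * w3 + b * t3 = c"
    and ab: "a \<noteq> 0 \<or> b \<noteq> 0"
  shows False
proof (cases "b = 0")
  case True
  then have w: "w1 = w2" "w3 = w2" using line ab by auto
  have vert: "A * t\<^sup>2 + (- (B * w2)) * t + (- C * w2\<^sup>2 + k * w2 - A * m) = 0" if "G w2 t = 0" for t
    using that by (simp add: G_def algebra_simps)
  show False
    using quadratic_three_roots(1)[OF vert vert vert, of t1 t2 t3] P dist A w by auto
next
  case b: False
  \<comment> \<open>The coefficients of \<open>b ^ 2 * G w t\<close> as a polynomial in
    \<open>w\<close> after substituting \<open>b * t = c - a * w\<close>.\<close>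
  define a2 a1 a0 where "a2 = A * a\<^sup>2 + B * a * b - C * b\<^sup>2"
    and "a1 = - 2 * A * a * c - B * b * c + k * b\<^sup>2" and "a0 = A * c\<^sup>2 - A * b\<^sup>2 * m"
  have root: "a2 * w\<^sup>2 + a1 * w + a0 = 0" if "G w t = 0" "a * w + b * t = c" for w t
    using that unfolding a2_def a1_def a0_def G_def by Groebner_Basis.algebra
  have ne: "w \<noteq> w'" if "(w, t) \<noteq> (w', t')" "a * w + b * t = c" "a * w' + b * t' = c" for w t w' t'
    using that b by auto
  have zero: "a2 = 0" "a1 = 0" "a0 = 0"
    using quadratic_three_roots[OF root[OF P(1) line(1)] root[OF P(2) line(2)] root[OF P(3) line(3)]]
      ne[OF dist(1) line(1,2)] ne[OF dist(2) line(2,3)] ne[OF dist(3) line(1,3)] by auto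
  have c2: "c\<^sup>2 = b\<^sup>2 * m"
  proof -
    have "A * (c\<^sup>2 - b\<^sup>2 * m) = 0" using zero(3) unfolding a0_def by Groebner_Basis.algebra
    then show ?thesis using A by simp
  qed
  have "b ^ 4 * (k\<^sup>2 - m * (B\<^sup>2 + 4 * A * C)) = 0"
    using c2 zero(1,2) unfolding a2_def a1_def by Groebner_Basis.algebra
  then show False using b nondeg by simp
qed

text \<open>Subtracting the equations at \<open>P\<close> and at \<open>P - d\<close> cancels the
  quadratic terms in \<open>P\<close> and leaves a line, which carries at most two points of the
  conic.\<close>

lemma fibre:
  assumes d: "d \<noteq> 0" and S: "finite S" "\<And>w t. (w, t) \<in> S \<Longrightarrow> G w t = 0"
  shows "card {P \<in> S. P - d \<in> S} \<le> 2"
proof -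
  obtain x y where xy: "d = (x, y)" by force
  define a b c where "a = - (2 * C * x) - B * y" and "b = 2 * A * y - B * x"
    and "c = A * y\<^sup>2 - B * x * y - C * x\<^sup>2 - k * x"
  have line: "a * w + b * t = c" if "G w t = 0" "G (w - x) (t - y) = 0" for w t
    using that unfolding a_def b_def c_def G_def by Groebner_Basis.algebra
  show ?thesis
  proof (cases "a = 0 \<and> b = 0")
    \<comment> \<open>Here \<open>d\<close> lies in the kernel of the quadratic part of
      \<open>G\<close>. A single point would then force \<open>k = 0\<close> and
      \<open>B ^ 2 + 4 * A * C = 0\<close>, against \<open>nondeg\<close>.\<close>
    case True
    have "{P \<in> S. P - d \<in> S} = {}"
    proof (rule ccontr)
      assume "{P \<in> S. P - d \<in> S} \<noteq> {}"
      then obtain w t where "(w, t) \<in> S" "(w - x, t - y) \<in> S" using xy by auto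
      then have "c = 0" using S(2) line True by fastforce
      then have kx: "2 * k * x = 0" using True unfolding a_def b_def c_def by Groebner_Basis.algebra
      have x: "x \<noteq> 0"
      proof
        assume "x = 0"
        then have "A * y = 0" using True by (simp add: b_def)
        then show False using A \<open>x = 0\<close> xy d by (simp add: zero_prod_def)
      qed
      have "x * (B\<^sup>2 + 4 * A * C) = 0" using True unfolding a_def b_def by Groebner_Basis.algebra
      then show False using x kx nondeg by simp
    qed
    then show ?thesis by (metis card.empty zero_le)
  next
    case False
    show ?thesis
    proof (rule card_le_2I)
      show "finite {P \<in> S. P - d \<in> S}" using S(1) by simp
      fix P Q R assume mem: "P \<in> {P \<in> S. P - d \<in> S}" "Q \<in> {P \<in> S. P - d \<in> S}" "R \<in> {P \<in> S. P - d \<in> S}"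
        and ne: "P \<noteq> Q" "Q \<noteq> R" "P \<noteq> R"
      obtain w1 t1 w2 t2 w3 t3 where e: "P = (w1, t1)" "Q = (w2, t2)" "R = (w3, t3)"
        by (metis surj_pair)
      have "G w1 t1 = 0" "G w2 t2 = 0" "G w3 t3 = 0" using mem S(2) e by auto
      moreover have "G (w1 - x) (t1 - y) = 0" "G (w2 - x) (t2 - y) = 0" "G (w3 - x) (t3 - y) = 0"
        using mem S(2) e xy by auto
      ultimately show False
        using no_three_collinear[of w1 t1 w2 t2 w3 t3 a b c] line ne e False by blast
    qed
  qed
qed

definition pts :: "nat \<Rightarrow> (int \<times> int) set"
  where "pts n = {(w, t) \<in> symm_ints n \<times> symm_ints n. G w t = 0}"

lemma finite_pts: "finite (pts n)"
proof -
  have "pts n \<subseteq> symm_ints n \<times> symm_ints n" by (auto simp: pts_def)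
  then show ?thesis by (rule finite_subset) simp
qed

text \<open>
  The difference of two values of a quadratic is its mean gradient times the displacement. So points
  of the conic at which the gradient has the same signs are pairwise comparable.
\<close>
lemma signed_chain:
  fixes i j :: int
  assumes ij: "i = 1 \<or> i = -1" "j = 1 \<or> j = -1"
    and "G w t = 0" "0 \<le> i * Gw w t" "0 \<le> j * Gt w t"
    and "G w' t' = 0" "0 \<le> i * Gw w' t'" "0 \<le> j * Gt w' t'"
  shows "0 \<le> - (i * j) * ((w' - w) * (t' - t))"
proof -
  define u v where "u = Gw w t + Gw w' t'" and "v = Gt w t + Gt w' t'"
  have eq: "u * (w' - w) + v * (t' - t) = 0"
    using G_diff[of w' t' w t] assms(3,6) by (simp add: u_def v_def)
  have sgn: "0 \<le> i * u" "0 \<le> j * v" using assms(4,5,7,8) by (simp_all add: u_def v_def algebra_simps)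
  have nz: "u \<noteq> 0 \<or> v \<noteq> 0"
  proof (rule ccontr)
    assume "\<not> ?thesis"
    then have "Gw w t = 0" "Gt w t = 0"
      using assms(4,5,7,8) ij unfolding u_def v_def by auto
    then show False using smooth[OF assms(3)] by simp
  qed
  show ?thesis
  proof (cases "u = 0")
    case True
    then have "t' - t = 0" using eq nz by simp
    then show ?thesis by simp
  next
    case False
    then have iu: "0 < i * u" using sgn ij by auto
    \<comment> \<open>Replacing \<open>u * (w' - w)\<close> by \<open>- v * (t' - t)\<close>
      exhibits the sign of the product.\<close>
    have "(i * u) * (- (i * j) * ((w' - w) * (t' - t))) = (i * i) * ((j * v) * (t' - t)\<^sup>2)"
      using eq by Groebner_Basis.algebra
    also have "\<dots> \<ge> 0" using sgn by simp
    finally have "i * u * 0 \<le> i * u * (- (i * j) * ((w' - w) * (t' - t)))" by simp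
    then show ?thesis using iu by (simp only: mult_le_cancel_left_pos)
  qed
qed

text \<open>The signs of the two partial derivatives split the conic into four classes, possibly
  overlapping, each of which is a chain of orientation \<open>- (i * j)\<close>.\<close>

lemma card_pts_le_mesh:
  assumes "L > 0"
  shows "card (pts n) \<le> 4 * (4 * (n div L) + 5 + 8 * L\<^sup>2)"
proof -
  define cl where "cl = (\<lambda>(i::int, j::int). {(w, t) \<in> pts n. 0 \<le> i * Gw w t \<and> 0 \<le> j * Gt w t})"
  define sg where "sg = {1, -1::int} \<times> {1, -1::int}"
  have fin: "finite (cl s)" for s
    by (rule finite_subset[OF _ finite_pts[of n]]) (auto simp: cl_def split: prod.splits)
  have bound: "card (cl s) \<le> 4 * (n div L) + 5 + 8 * L\<^sup>2" if s: "s \<in> sg" for s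
  proof -
    obtain i j where ij: "s = (i, j)" "i = 1 \<or> i = -1" "j = 1 \<or> j = -1"
      using s by (auto simp: sg_def)
    show ?thesis
    proof (rule card_chain_le[OF assms, of "- (i * j)"])
      show "- (i * j) = 1 \<or> - (i * j) = - 1" using ij by auto
      show "cl s \<subseteq> symm_ints n \<times> symm_ints n" by (auto simp: cl_def pts_def ij)
      show "0 \<le> - (i * j) * ((w' - w) * (t' - t))" if "(w, t) \<in> cl s" "(w', t') \<in> cl s" for w t w' t'
        using that by (intro signed_chain[OF ij(2,3)]) (auto simp: cl_def pts_def ij(1))
      show "card {P \<in> cl s. P - d \<in> cl s} \<le> 2" if "d \<noteq> 0" for d
        by (intro fibre[OF that] fin) (auto simp: cl_def pts_def ij(1))
    qed
  qed
  have "pts n \<subseteq> (\<Union>s\<in>sg. cl s)"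
  proof
    fix P assume P: "P \<in> pts n"
    obtain w t where e: "P = (w, t)" by force
    have "P \<in> cl (if 0 \<le> Gw w t then 1 else -1, if 0 \<le> Gt w t then 1 else -1)"
      using P by (auto simp: cl_def e)
    then show "P \<in> (\<Union>s\<in>sg. cl s)" by (auto simp: sg_def split: if_splits)
  qed
  moreover have "finite (\<Union>s\<in>sg. cl s)"
    using fin by (simp add: sg_def)
  ultimately have "card (pts n) \<le> card (\<Union>s\<in>sg. cl s)" by (intro card_mono)
  also have "\<dots> \<le> (\<Sum>s\<in>sg. card (cl s))" by (rule card_UN_le) (simp add: sg_def)
  also have "\<dots> \<le> (\<Sum>s\<in>sg. 4 * (n div L) + 5 + 8 * L\<^sup>2)" by (intro sum_mono bound)
  also have "\<dots> = 4 * (4 * (n div L) + 5 + 8 * L\<^sup>2)"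
    unfolding sum_constant by (simp add: sg_def card_cartesian_product)
  finally show ?thesis .
qed

text \<open>A mesh \<open>L\<close> of order \<open>n powr (1 / 3)\<close> balances the
  \<open>n / L\<close> cells against the \<open>L ^ 2\<close> displacements. The constant is
  \<open>4 * (4 + 5 + 8 * 4)\<close>, where the last 4 comes from
  \<open>L \<le> 2 * x\<close>.\<close>

lemma card_pts_le:
  assumes "n > 0"
  shows "real (card (pts n)) \<le> 164 * real n powr (2 / 3)"
proof -
  define x where "x = real n powr (1 / 3)"
  have x1: "x \<ge> 1" using assms by (simp add: x_def ge_one_powr_ge_zero)
  have x2: "x\<^sup>2 = real n powr (2 / 3)" and x3: "x ^ 3 = real n"
    using assms by (simp_all add: x_def powr_power)
  define L where "L = nat \<lceil>x\<rceil>"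
  have L: "x \<le> real L" "real L \<le> 2 * x" "L > 0" using x1 unfolding L_def by linarith+
  have "real (n div L) \<le> real n / real L" by (rule of_nat_div_le_of_nat)
  also have "\<dots> \<le> real n / x" using L x1 by (intro divide_left_mono) auto
  also have "\<dots> = x\<^sup>2" using x1 by (simp add: x3[symmetric] power3_eq_cube power2_eq_square)
  finally have 1: "real (n div L) \<le> x\<^sup>2" .
  have "(real L)\<^sup>2 \<le> (2 * x)\<^sup>2" using L by (intro power_mono) auto
  then have 2: "(real L)\<^sup>2 \<le> 4 * x\<^sup>2" by (simp add: power_mult_distrib)
  have 3: "1 \<le> x\<^sup>2" using x1 by simp
  have lin: "4 * (4 * a + 5 + 8 * b) \<le> 164 * c" if "a \<le> c" "b \<le> 4 * c" "1 \<le> c" for a b c :: real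
    using that by (simp add: algebra_simps)
  have "real (card (pts n)) \<le> real (4 * (4 * (n div L) + 5 + 8 * L\<^sup>2))"
    using card_pts_le_mesh[OF L(3)] of_nat_le_iff by blast
  also have "\<dots> = 4 * (4 * real (n div L) + 5 + 8 * (real L)\<^sup>2)" by simp
  also have "\<dots> \<le> 164 * x\<^sup>2" using 1 2 3 by (rule lin)
  finally show ?thesis by (simp add: x2)
qed

end

section \<open>The quadric \<open>p * w + t ^ 2 = m\<close> and its plane sections\<close>

lemma card_symm_ints_le:
  assumes "n > 0"
  shows "real (card (symm_ints n)) \<le> 3 * real n"
  using assms by simp

lemma card_Sigma_le:
  assumes "finite A" "\<And>x. x \<in> A \<Longrightarrow> finite (B x)"
    and "\<And>x. x \<in> A \<Longrightarrow> real (card (B x)) \<le> c"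
  shows "real (card (Sigma A B)) \<le> real (card A) * c"
proof -
  have "card (Sigma A B) = (\<Sum>x\<in>A. card (B x))" using assms(1,2) by (intro card_SigmaI) auto
  then show ?thesis using sum_bounded_above[of A "\<lambda>x. real (card (B x))" c] assms(3) by simp
qed

definition quadric_pts :: "nat \<Rightarrow> int \<Rightarrow> (int \<times> int \<times> int) set"
  where "quadric_pts n m = {(p, t, w) \<in> symm_ints n \<times> symm_ints n \<times> symm_ints n. p * w + t\<^sup>2 = m}"

lemma finite_quadric_pts: "finite (quadric_pts n m)"
proof -
  have "quadric_pts n m \<subseteq> symm_ints n \<times> symm_ints n \<times> symm_ints n" by (auto simp: quadric_pts_def)
  then show ?thesis by (rule finite_subset) simp
qed

lemma abs_mult_le_square:
  assumes "x \<in> symm_ints n" "y \<in> symm_ints n"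
  shows "\<bar>x * y\<bar> \<le> (int n)\<^sup>2"
proof -
  have "\<bar>x\<bar> * \<bar>y\<bar> \<le> int n * int n" using assms by (intro mult_mono) auto
  then show ?thesis by (simp add: abs_mult power2_eq_square)
qed

lemma card_divisors_square_le:
  assumes C: "C \<ge> 0" "\<And>a::int. a \<noteq> 0 \<Longrightarrow> real (card {d. d dvd a}) \<le> C * \<bar>real_of_int a\<bar> powr \<epsilon>"
    and "\<epsilon> > 0" "a \<noteq> 0" "\<bar>a\<bar> \<le> c * int n ^ j" "n > 0"
  shows "real (card {d. d dvd a}) \<le> C * (real_of_int c powr \<epsilon> * real n powr (real j * \<epsilon>))"
proof -
  have "\<bar>real_of_int a\<bar> \<le> real_of_int (c * int n ^ j)"
    using assms(5) by (metis of_int_abs of_int_le_iff)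
  then have le: "\<bar>real_of_int a\<bar> \<le> real_of_int c * real n ^ j" by simp
  have "0 < \<bar>real_of_int a\<bar>" using assms(4) by simp
  then have "0 < real_of_int c * real n ^ j" using le by linarith
  then have c: "real_of_int c > 0" using assms(6) by (simp add: zero_less_mult_iff)
  have "\<bar>real_of_int a\<bar> powr \<epsilon> \<le> (real_of_int c * real n ^ j) powr \<epsilon>"
    using le assms(3) by (intro powr_mono2) auto
  also have "\<dots> = real_of_int c powr \<epsilon> * real n powr (real j * \<epsilon>)"
    using c assms(6) by (simp add: powr_mult powr_realpow[symmetric] powr_powr)
  finally show ?thesis 
    using order_trans[OF C(2)[OF assms(4)] mult_left_mono[OF _ C(1)]] by simp
qed

text \<open>If \<open>m - t ^ 2\<close> is nonzero, \<open>p\<close> is one of its divisors and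
  fixes \<open>w\<close>. Otherwise \<open>t\<close> is a square root of \<open>m\<close>, and
  \<open>p * w = 0\<close> leaves linearly many pairs.\<close>

lemma card_quadric_pts_le:
  fixes \<epsilon> :: real
  assumes "\<epsilon> > 0"
  obtains K where "K \<ge> 0" "\<And>n m. n > 0 \<Longrightarrow> real (card (quadric_pts n m)) \<le> K * real n powr (1 + \<epsilon>)"
proof -
  obtain C where C: "C \<ge> 1" "\<And>a::int. a \<noteq> 0 \<Longrightarrow> real (card {d. d dvd a}) \<le> C * \<bar>real_of_int a\<bar> powr (\<epsilon> / 2)"
    using divisor_bound_int[of "\<epsilon> / 2"] assms by auto
  show ?thesis
  proof (rule that)
    show "3 * C + 12 \<ge> 0" using C by simp
    fix n :: nat and m :: int assume n: "n > 0"
    define S where "S = {(p, t, w) \<in> quadric_pts n m. p * w \<noteq> 0}"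
    define Z where "Z = {(p, t, w) \<in> quadric_pts n m. p * w = 0}"
    define I where "I = {t \<in> symm_ints n. m - t\<^sup>2 \<noteq> 0 \<and> \<bar>m - t\<^sup>2\<bar> \<le> 1 * int n ^ 2}"
    have finI: "finite I" by (rule finite_subset[of _ "symm_ints n"]) (auto simp: I_def)
    have "real (card S) \<le> real (card (SIGMA t:I. {d. d dvd m - t\<^sup>2}))"
    proof (rule of_nat_mono, rule card_inj_on_le)
      show "inj_on (\<lambda>(p, t, w). (t, p)) S"
        by (auto simp: inj_on_def S_def quadric_pts_def)
      show "(\<lambda>(p, t, w). (t, p)) ` S \<subseteq> (SIGMA t:I. {d. d dvd m - t\<^sup>2})"
      proof (clarsimp simp: S_def)
        fix p t w assume h: "(p, t, w) \<in> quadric_pts n m" "p \<noteq> 0" "w \<noteq> 0"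
        then have e: "m - t\<^sup>2 = p * w" by (auto simp: quadric_pts_def)
        then show "t \<in> I \<and> p dvd m - t\<^sup>2"
          using h abs_mult_le_square[of p n w] by (auto simp: I_def quadric_pts_def)
      qed
      show "finite (SIGMA t:I. {d. d dvd m - t\<^sup>2})"
        using finI by (intro finite_SigmaI finite_divisors_int) (auto simp: I_def)
    qed
    also have "\<dots> \<le> real (card I) * (C * (1 powr (\<epsilon> / 2) * real n powr (real 2 * (\<epsilon> / 2))))"
    proof (rule card_Sigma_le)
      show "finite I" by (rule finI)
      fix t assume t: "t \<in> I"
      then show "finite {d. d dvd m - t\<^sup>2}" by (intro finite_divisors_int) (simp add: I_def)
      show "real (card {d. d dvd m - t\<^sup>2}) \<le> C * (1 powr (\<epsilon> / 2) * real n powr (real 2 * (\<epsilon> / 2)))"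
        using card_divisors_square_le[OF _ C(2), where c = 1 and n = n and j = 2 and a = "m - t\<^sup>2"] C(1) assms t n
        by (simp add: I_def)
    qed
    also have "\<dots> = real (card I) * (C * real n powr \<epsilon>)" by simp
    also have "\<dots> \<le> (3 * real n) * (C * real n powr \<epsilon>)"
    proof (rule mult_right_mono)
      have "card I \<le> card (symm_ints n)" by (intro card_mono) (auto simp: I_def)
      then show "real (card I) \<le> 3 * real n" using card_symm_ints_le[OF n] by linarith
    qed (use C in simp)
    finally have S: "real (card S) \<le> 3 * C * real n powr (1 + \<epsilon>)"
      using n by (simp add: powr_add mult_ac)
    have "card {t. t\<^sup>2 = m} \<le> 2 \<and> finite {t. t\<^sup>2 = m}"
    proof (cases "\<exists>u. u\<^sup>2 = m")
      case True
      then obtain u where "u\<^sup>2 = m" by blast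
      then have "{t. t\<^sup>2 = m} = {u, - u}" by (auto simp: power2_eq_iff)
      then show ?thesis by (simp add: card_insert_if)
    next
      case False
      then have "{t. t\<^sup>2 = m} = {}" by auto
      then show ?thesis by (metis card.empty finite.emptyI zero_le)
    qed
    then have T: "real (card {t. t\<^sup>2 = m}) \<le> 2" "finite {t. t\<^sup>2 = m}" by auto
    define X where "X = {0::int} \<times> symm_ints n \<union> symm_ints n \<times> {0}"
    have X: "finite X" "real (card X) \<le> 6 * real n"
    proof -
      show "finite X" by (simp add: X_def)
      have "card X \<le> card ({0::int} \<times> symm_ints n) + card (symm_ints n \<times> {0::int})"
        unfolding X_def by (rule card_Un_le)
      then show "real (card X) \<le> 6 * real n"
        using card_symm_ints_le[OF n] by (simp add: card_cartesian_product)
    qed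
    have "real (card Z) \<le> real (card ({t. t\<^sup>2 = m} \<times> X))"
    proof (rule of_nat_mono, rule card_inj_on_le)
      show "inj_on (\<lambda>(p, t, w). (t, p, w)) Z" by (auto simp: inj_on_def)
      show "(\<lambda>(p, t, w). (t, p, w)) ` Z \<subseteq> {t. t\<^sup>2 = m} \<times> X"
        by (auto simp: Z_def quadric_pts_def X_def)
    qed (use T X in simp)
    also have "\<dots> = real (card {t. t\<^sup>2 = m}) * real (card X)" by (simp add: card_cartesian_product)
    also have "\<dots> \<le> 2 * (6 * real n)" using T X by (intro mult_mono) auto
    also have "\<dots> \<le> 12 * real n powr (1 + \<epsilon>)"
      using n assms powr_mono[of 1 "1 + \<epsilon>" "real n"] by simp
    finally have Z: "real (card Z) \<le> 12 * real n powr (1 + \<epsilon>)" .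
    have "quadric_pts n m = S \<union> Z" by (auto simp: S_def Z_def)
    then have "card (quadric_pts n m) \<le> card S + card Z" by (simp add: card_Un_le)
    then show "real (card (quadric_pts n m)) \<le> (3 * C + 12) * real n powr (1 + \<epsilon>)"
      using S Z by (simp add: algebra_simps)
  qed
qed

text \<open>If \<open>A\<close> or \<open>C\<close> is nonzero, the plane equation eliminates
  \<open>p\<close> or \<open>w\<close> and leaves a smooth conic; the two cases are exchanged by
  symmetry. If both vanish, the plane fixes \<open>t = t0\<close>, and \<open>p\<close> divides
  \<open>m - t0 ^ 2\<close>, which is nonzero by nondegeneracy.\<close>

lemma card_plane_section_le:
  obtains K where "K \<ge> 0"
    "\<And>n A B C k m. \<lbrakk>n > 0; m * (B\<^sup>2 + 4 * A * C) \<noteq> k\<^sup>2\<rbrakk> \<Longrightarrow>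
       real (card {(p, t, w) \<in> quadric_pts n m. A * p + B * t + C * w = k}) \<le> K * real n powr (2 / 3)"
proof -
  \<comment> \<open>The divisors are those of an integer of size at most \<open>n ^ 2\<close>, so
    the exponent \<open>1 / 3\<close> yields \<open>n powr (2 / 3)\<close>.\<close>
  obtain D where D: "D \<ge> 1" "\<And>a::int. a \<noteq> 0 \<Longrightarrow> real (card {d. d dvd a}) \<le> D * \<bar>real_of_int a\<bar> powr (1 / 3)"
    using divisor_bound_int[of "1 / 3"] by auto
  show ?thesis
  proof (rule that)
    show "164 + D \<ge> 0" using D by simp
    fix n :: nat and A B C k m :: int
    assume n: "n > 0" and nondeg: "m * (B\<^sup>2 + 4 * A * C) \<noteq> k\<^sup>2"
    define S where "S = {(p, t, w) \<in> quadric_pts n m. A * p + B * t + C * w = k}"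
    have 164: "real (card S) \<le> (164 + D) * real n powr (2 / 3)"
      if "real (card S) \<le> 164 * real n powr (2 / 3)"
      using that D by (simp add: distrib_right add_increasing2)
    consider "A \<noteq> 0" | "C \<noteq> 0" | "A = 0" "C = 0" by blast
    then have "real (card S) \<le> (164 + D) * real n powr (2 / 3)"
    proof cases
      case 1
      then interpret plane_conic A B C k m using nondeg by unfold_locales
      have "card S \<le> card (pts n)"
      proof (rule card_inj_on_le)
        show "inj_on (\<lambda>(p, t, w). (w, t)) S" using 1 by (auto simp: inj_on_def S_def)
        have "G w t = 0" if "p * w + t\<^sup>2 = m" "A * p + B * t + C * w = k" for p t w
          using that unfolding G_def unfolding that[symmetric] by (simp add: algebra_simps power2_eq_square)
        then show "(\<lambda>(p, t, w). (w, t)) ` S \<subseteq> pts n"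
          by (auto simp: S_def quadric_pts_def pts_def)
      qed (rule finite_pts)
      then show ?thesis using card_pts_le[OF n] 164 by linarith
    next
      case 2
      then interpret plane_conic C B A k m using nondeg by unfold_locales (auto simp: mult_ac)
      have "card S \<le> card (pts n)"
      proof (rule card_inj_on_le)
        show "inj_on (\<lambda>(p, t, w). (p, t)) S" using 2 by (auto simp: inj_on_def S_def)
        have "G p t = 0" if "p * w + t\<^sup>2 = m" "A * p + B * t + C * w = k" for p t w
          using that unfolding G_def unfolding that[symmetric] by (simp add: algebra_simps power2_eq_square)
        then show "(\<lambda>(p, t, w). (p, t)) ` S \<subseteq> pts n"
          by (auto simp: S_def quadric_pts_def pts_def)
      qed (rule finite_pts)
      then show ?thesis using card_pts_le[OF n] 164 by linarith
    next
      case 3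
      show ?thesis
      proof (cases "S = {}")
        case True
        then show ?thesis using D by simp
      next
        case False
        then obtain p0 t0 w0 where S0: "(p0, t0, w0) \<in> S" by auto
        have B: "B \<noteq> 0" using S0 nondeg 3 by (auto simp: S_def)
        have t: "t = t0" if "(p, t, w) \<in> S" for p t w
          using that S0 B 3 by (auto simp: S_def)
        have k: "k = B * t0" using S0 3 by (auto simp: S_def)
        have nz: "m - t0\<^sup>2 \<noteq> 0" using nondeg 3 unfolding k by (auto simp: power_mult_distrib)
        have e: "m - t0\<^sup>2 = p * w" if "(p, t, w) \<in> S" for p t w
          using that t[OF that] by (auto simp: S_def quadric_pts_def)
        have small: "\<bar>m - t0\<^sup>2\<bar> \<le> 1 * int n ^ 2"
          using e[OF S0] abs_mult_le_square[of p0 n w0] S0 by (auto simp: S_def quadric_pts_def)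
        have "card S \<le> card {d. d dvd m - t0\<^sup>2}"
        proof (rule card_inj_on_le)
          show "inj_on (\<lambda>(p, t, w). p) S"
          proof (rule inj_onI)
            fix x y assume h: "x \<in> S" "y \<in> S" "(case x of (p, t, w) \<Rightarrow> p) = (case y of (p, t, w) \<Rightarrow> p)"
            obtain p t w t' w' where xy: "x = (p, t, w)" "y = (p, t', w')"
              using h(3) by (cases x; cases y) auto
            then have "p * w = p * w'" "p \<noteq> 0"
              using e[of p t w] e[of p t' w'] h nz by auto
            then show "x = y" using t[of p t w] t[of p t' w'] h xy by simp
          qed
          show "(\<lambda>(p, t, w). p) ` S \<subseteq> {d. d dvd m - t0\<^sup>2}" using e by auto
        qed (rule finite_divisors_int[OF nz])
        also have "real \<dots> \<le> D * (real_of_int 1 powr (1 / 3) * real n powr (real 2 * (1 / 3)))"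
          using D n nz small by (intro card_divisors_square_le) auto
        finally have "real (card S) \<le> D * real n powr (2 / 3)" by simp
        then show ?thesis by (simp add: distrib_right add_increasing)
      qed
    qed
    then show "real (card {(p, t, w) \<in> quadric_pts n m. A * p + B * t + C * w = k}) \<le> (164 + D) * real n powr (2 / 3)"
      by (simp add: S_def)
  qed
qed

section \<open>Forms whose discriminant quartic has a rational root\<close>

text \<open>
  The tuple \<open>(a\<^sub>0, a\<^sub>1, a\<^sub>2, g\<^sub>0, g\<^sub>1, g\<^sub>2)\<close> stands for \<open>(b\<^sub>1\<^sub>1, b\<^sub>1\<^sub>2, b\<^sub>2\<^sub>2, b\<^sub>3\<^sub>3, b\<^sub>3\<^sub>4, b\<^sub>4\<^sub>4)\<close> and \<open>(p, t, w)\<close> for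
  \<open>(b\<^sub>1\<^sub>3, b\<^sub>1\<^sub>4, b\<^sub>2\<^sub>4)\<close>. Then \<open>q(B) = -(pairing + 2 (p w + t\<^sup>2))\<close>, and \<open>root_poly\<close> is the
  discriminant in \<open>y\<close> of the \<open>(2,2)\<close>-form, as a binary quartic in \<open>x = (r, s)\<close>.
\<close>
type_synonym ends = "int \<times> int \<times> int \<times> int \<times> int \<times> int"

definition ends_box :: "nat \<Rightarrow> ends set"
  where "ends_box n = symm_ints n \<times> symm_ints n \<times> symm_ints n \<times> symm_ints n \<times> symm_ints n \<times> symm_ints n"

definition root_poly :: "'a::comm_ring_1 \<Rightarrow> 'a \<Rightarrow> 'a \<Rightarrow> 'a \<Rightarrow> 'a \<Rightarrow> 'a \<Rightarrow> 'a \<Rightarrow> 'a \<Rightarrow> 'a \<Rightarrow> 'a \<Rightarrow> 'a \<Rightarrow> 'a"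
  where "root_poly a0 a1 a2 g0 g1 g2 p t w r s =
    (a1 * r\<^sup>2 - 2 * t * r * s - g1 * s\<^sup>2)\<^sup>2
      - (a0 * r\<^sup>2 + 2 * p * r * s + g0 * s\<^sup>2) * (a2 * r\<^sup>2 - 2 * w * r * s + g2 * s\<^sup>2)"

definition pairing :: "'a::comm_ring_1 \<Rightarrow> 'a \<Rightarrow> 'a \<Rightarrow> 'a \<Rightarrow> 'a \<Rightarrow> 'a \<Rightarrow> 'a"
  where "pairing a0 a1 a2 g0 g1 g2 = a0 * g2 + a2 * g0 + 2 * a1 * g1"

definition tangency :: "int \<Rightarrow> int \<Rightarrow> int \<Rightarrow> int \<Rightarrow> int \<Rightarrow> int \<Rightarrow> int \<Rightarrow> int \<Rightarrow> int"
  where "tangency a0 a1 a2 g0 g1 g2 r s =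
    r ^ 4 * (a1\<^sup>2 - a0 * a2) + s ^ 4 * (g1\<^sup>2 - g0 * g2) + pairing a0 a1 a2 g0 g1 g2 * r\<^sup>2 * s\<^sup>2"

text \<open>Outside this set the integers whose divisors are counted are nonzero:
  \<open>a1 ^ 2 - a0 * a2\<close> and \<open>g1 ^ 2 - g0 * g2\<close> for the roots, and the
  right-hand side of \<open>tangent_factorisation\<close>.\<close>

definition exceptional :: "nat \<Rightarrow> ends set"
  where "exceptional n = {(a0, a1, a2, g0, g1, g2) \<in> ends_box n.
    a0 = 0 \<or> g0 = 0 \<or> a1\<^sup>2 = a0 * a2 \<or> g1\<^sup>2 = g0 * g2 \<or> a0 * g1 + a1 * g0 = 0}"

text \<open>For these tuples some \<open>(r : s)\<close> gives a plane touching the quadric, so the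
  section may degenerate and all points of the quadric are counted instead.\<close>

definition tangent :: "nat \<Rightarrow> ends set"
  where "tangent n = {(a0, a1, a2, g0, g1, g2) \<in> ends_box n - exceptional n.
    \<exists>r s. s \<noteq> 0 \<and> coprime r s \<and> tangency a0 a1 a2 g0 g1 g2 r s = 0}"

section \<open>Rarity of the exceptional and tangent tuples\<close>

lemma finite_ends_box: "finite (ends_box n)"
  by (simp add: ends_box_def)

lemma card_ends_box_le:
  assumes "n > 0"
  shows "real (card (ends_box n)) \<le> 729 * real n ^ 6"
proof -
  have "real (card (ends_box n)) = real (card (symm_ints n)) ^ 6"
    unfolding ends_box_def card_cartesian_product by (simp only: of_nat_mult) (simp add: eval_nat_numeral)
  also have "\<dots> \<le> (3 * real n) ^ 6" using card_symm_ints_le[OF assms] by (intro power_mono) auto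
  finally show ?thesis by (simp add: power_mult_distrib)
qed

definition box5 :: "nat \<Rightarrow> (int \<times> int \<times> int \<times> int \<times> int) set"
  where "box5 n = symm_ints n \<times> symm_ints n \<times> symm_ints n \<times> symm_ints n \<times> symm_ints n"

lemma finite_box5: "finite (box5 n)"
  by (simp add: box5_def)

lemma card_box5_le:
  assumes "n > 0"
  shows "real (card (box5 n)) \<le> 243 * real n ^ 5"
proof -
  have "real (card (box5 n)) = real (card (symm_ints n)) ^ 5"
    unfolding box5_def card_cartesian_product by (simp only: of_nat_mult) (simp add: eval_nat_numeral)
  also have "\<dots> \<le> (3 * real n) ^ 5" using card_symm_ints_le[OF assms] by (intro power_mono) auto
  finally show ?thesis by (simp add: power_mult_distrib)
qed

text \<open>Each of the five conditions determines one coordinate from the other five: after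
  \<open>a0 = 0\<close> and \<open>g0 = 0\<close> are set apart, the remaining equations can be
  solved for \<open>a2\<close>, \<open>g2\<close> and \<open>g1\<close>.\<close>

lemma card_exceptional_le:
  assumes "n > 0"
  shows "real (card (exceptional n)) \<le> 1215 * real n ^ 5"
proof -
  define E1 where "E1 = {(a0, a1, a2, g0, g1, g2) \<in> ends_box n. a0 = 0}"
  define E2 where "E2 = {(a0, a1, a2, g0, g1, g2) \<in> ends_box n. g0 = 0}"
  define E3 where "E3 = {(a0, a1, a2, g0, g1, g2) \<in> ends_box n. a0 \<noteq> 0 \<and> a1\<^sup>2 = a0 * a2}"
  define E4 where "E4 = {(a0, a1, a2, g0, g1, g2) \<in> ends_box n. g0 \<noteq> 0 \<and> g1\<^sup>2 = g0 * g2}"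
  define E5 where "E5 = {(a0, a1, a2, g0, g1, g2) \<in> ends_box n. a0 \<noteq> 0 \<and> a0 * g1 = - (a1 * g0)}"
  have 1: "card E1 \<le> card (box5 n)"
    by (rule card_inj_on_le[of "\<lambda>(a0, a1, a2, g0, g1, g2). (a1, a2, g0, g1, g2)"])
      (auto simp: inj_on_def E1_def ends_box_def box5_def)
  have 2: "card E2 \<le> card (box5 n)"
    by (rule card_inj_on_le[of "\<lambda>(a0, a1, a2, g0, g1, g2). (a0, a1, a2, g1, g2)"])
      (auto simp: inj_on_def E2_def ends_box_def box5_def)
  have 3: "card E3 \<le> card (box5 n)"
    by (rule card_inj_on_le[of "\<lambda>(a0, a1, a2, g0, g1, g2). (a0, a1, g0, g1, g2)"])
      (auto simp: inj_on_def E3_def ends_box_def box5_def)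
  have 4: "card E4 \<le> card (box5 n)"
    by (rule card_inj_on_le[of "\<lambda>(a0, a1, a2, g0, g1, g2). (a0, a1, a2, g0, g1)"])
      (auto simp: inj_on_def E4_def ends_box_def box5_def)
  have 5: "card E5 \<le> card (box5 n)"
  proof (rule card_inj_on_le[of "\<lambda>(a0, a1, a2, g0, g1, g2). (a0, a1, a2, g0, g2)"])
    show "inj_on (\<lambda>(a0, a1, a2, g0, g1, g2). (a0, a1, a2, g0, g2)) E5"
    proof (rule inj_onI)
      fix x y :: ends
      assume h: "x \<in> E5" "y \<in> E5" "(case x of (a0, a1, a2, g0, g1, g2) \<Rightarrow> (a0, a1, a2, g0, g2)) =
        (case y of (a0, a1, a2, g0, g1, g2) \<Rightarrow> (a0, a1, a2, g0, g2))"
      obtain a0 a1 a2 g0 g1 g1' g2 where e: "x = (a0, a1, a2, g0, g1, g2)" "y = (a0, a1, a2, g0, g1', g2)"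
        using h(3) by (cases x; cases y) auto
      have "a0 * g1 = a0 * g1'" "a0 \<noteq> 0" using h(1,2) by (auto simp: E5_def e)
      then show "x = y" by (simp add: e)
    qed
  qed (auto simp: E5_def ends_box_def box5_def)
  have "exceptional n \<subseteq> E1 \<union> (E2 \<union> (E3 \<union> (E4 \<union> E5)))"
  proof
    fix x assume x: "x \<in> exceptional n"
    obtain a0 a1 a2 g0 g1 g2 where e: "x = (a0, a1, a2, g0, g1, g2)" by (cases x) auto
    show "x \<in> E1 \<union> (E2 \<union> (E3 \<union> (E4 \<union> E5)))"
      using x unfolding e exceptional_def E1_def E2_def E3_def E4_def E5_def eq_neg_iff_add_eq_0
      by blast
  qed
  moreover have "finite (E1 \<union> (E2 \<union> (E3 \<union> (E4 \<union> E5))))"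
    by (rule finite_subset[OF _ finite_ends_box[of n]])
      (auto simp: E1_def E2_def E3_def E4_def E5_def)
  ultimately have "card (exceptional n) \<le> card (E1 \<union> (E2 \<union> (E3 \<union> (E4 \<union> E5))))"
    by (rule card_mono[rotated])
  also have "\<dots> \<le> card E1 + (card E2 + (card E3 + (card E4 + card E5)))"
    by (intro order_trans[OF card_Un_le] add_left_mono card_Un_le)
  finally have "card (exceptional n) \<le> 5 * card (box5 n)" using 1 2 3 4 5 by linarith
  then have "real (card (exceptional n)) \<le> 5 * real (card (box5 n))" by linarith
  then show ?thesis using card_box5_le[OF assms] by linarith
qed

text \<open>Modulo \<open>s ^ 2\<close> only the term with \<open>r ^ 4\<close> survives in the
  tangency form, and \<open>r\<close> is a unit.\<close>

lemma square_dvd_of_tangency: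
  assumes "coprime r s" "tangency a0 a1 a2 g0 g1 g2 r s = 0"
  shows "s\<^sup>2 dvd a1\<^sup>2 - a0 * a2"
proof -
  define d0 d4 N where "d0 = a1\<^sup>2 - a0 * a2" and "d4 = g1\<^sup>2 - g0 * g2" and "N = pairing a0 a1 a2 g0 g1 g2"
  have "r ^ 4 * d0 + s ^ 4 * d4 + N * r\<^sup>2 * s\<^sup>2 = 0"
    using assms(2) by (simp add: tangency_def d0_def d4_def N_def)
  then have "r ^ 4 * d0 = s\<^sup>2 * (- (s\<^sup>2 * d4 + N * r\<^sup>2))" by Groebner_Basis.algebra
  then have "s\<^sup>2 dvd r ^ 4 * d0" by (metis dvd_triv_left)
  moreover have "coprime (s\<^sup>2) (r ^ 4)" using assms(1) by (simp add: coprime_commute)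
  ultimately show ?thesis by (simp add: coprime_dvd_mult_right_iff d0_def)
qed

text \<open>
  Tangency makes the discriminant of \<open>d\<^sub>0 x\<^sup>2 + N x y + d\<^sub>4 y\<^sup>2\<close> a square, where \<open>N\<close> is the pairing.
  As a polynomial in \<open>g\<^sub>2\<close> this discriminant has leading coefficient \<open>a\<^sub>0\<^sup>2\<close>; completing the square
  turns the condition into a factorisation of an integer that does not involve \<open>g\<^sub>2\<close>.
\<close>
lemma tangent_factorisation:
  assumes "s \<noteq> 0" "coprime r s" "tangency a0 a1 a2 g0 g1 g2 r s = 0"
  defines "d0 \<equiv> a1\<^sup>2 - a0 * a2"
  obtains z where "(a0\<^sup>2 * g2 + (a0 * (a2 * g0 + 2 * a1 * g1) + 2 * d0 * g0) - a0 * z) *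
    (a0\<^sup>2 * g2 + (a0 * (a2 * g0 + 2 * a1 * g1) + 2 * d0 * g0) + a0 * z) = 4 * d0 * (a1 * g0 + a0 * g1)\<^sup>2"
proof -
  obtain c where c: "d0 = s\<^sup>2 * c" using square_dvd_of_tangency[OF assms(2,3)] by (auto simp: d0_def)
  define N d4 where "N = pairing a0 a1 a2 g0 g1 g2" and "d4 = g1\<^sup>2 - g0 * g2"
  have "r ^ 4 * d0 + s ^ 4 * d4 + N * r\<^sup>2 * s\<^sup>2 = 0"
    using assms(3) by (simp add: tangency_def d0_def d4_def N_def)
  then have "s\<^sup>2 * (r ^ 4 * c + s\<^sup>2 * d4 + N * r\<^sup>2) = 0" unfolding c by Groebner_Basis.algebra
  then have e: "r ^ 4 * c + s\<^sup>2 * d4 + N * r\<^sup>2 = 0" using assms(1) by simp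
  \<comment> \<open>The quadratic \<open>c * x ^ 2 + N * x + s ^ 2 * d4\<close> has the root
    \<open>x = r ^ 2\<close>, so its discriminant is the square of its derivative there.\<close>
  have z: "(2 * c * r\<^sup>2 + N)\<^sup>2 = N\<^sup>2 - 4 * d0 * d4"
    using e unfolding c by Groebner_Basis.algebra
  show ?thesis
  proof (rule that[of "2 * c * r\<^sup>2 + N"])
    show "(a0\<^sup>2 * g2 + (a0 * (a2 * g0 + 2 * a1 * g1) + 2 * d0 * g0) - a0 * (2 * c * r\<^sup>2 + N)) *
      (a0\<^sup>2 * g2 + (a0 * (a2 * g0 + 2 * a1 * g1) + 2 * d0 * g0) + a0 * (2 * c * r\<^sup>2 + N)) =
      4 * d0 * (a1 * g0 + a0 * g1)\<^sup>2"
      using z unfolding N_def d4_def pairing_def d0_def by Groebner_Basis.algebra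
  qed
qed

text \<open>Five coordinates are free. By the factorisation the sixth is found from a divisor
  \<open>h\<close> of the nonzero integer \<open>M\<close>: the cofactor and hence \<open>U\<close>
  are determined, and \<open>U\<close> is linear in \<open>g2\<close> with leading coefficient
  \<open>a0 ^ 2\<close>.\<close>

lemma card_tangent_le:
  fixes \<epsilon> :: real
  assumes "\<epsilon> > 0"
  obtains K where "K \<ge> 0" "\<And>n. n > 0 \<Longrightarrow> real (card (tangent n)) \<le> K * real n powr (5 + \<epsilon>)"
proof -
  \<comment> \<open>The divided integer has size at most \<open>32 * n ^ 6\<close>, hence the
    exponent \<open>\<epsilon> / 6\<close> and the power of 32 in \<open>c\<close>.\<close>
  obtain D where D: "D \<ge> 1" "\<And>a::int. a \<noteq> 0 \<Longrightarrow> real (card {d. d dvd a}) \<le> D * \<bar>real_of_int a\<bar> powr (\<epsilon> / 6)"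
    using divisor_bound_int[of "\<epsilon> / 6"] assms by auto
  define c where "c = D * 32 powr (\<epsilon> / 6)"
  show ?thesis
  proof (rule that)
    show "243 * c \<ge> 0" using D by (simp add: c_def)
    fix n :: nat assume n: "n > 0"
    define M where "M = (\<lambda>(a0, a1, a2, g0, g1). 4 * (a1\<^sup>2 - a0 * a2) * (a1 * g0 + a0 * g1)\<^sup>2 :: int)"
    define U where "U = (\<lambda>(a0, a1, a2, g0, g1, g2).
      a0\<^sup>2 * g2 + (a0 * (a2 * g0 + 2 * a1 * g1) + 2 * (a1\<^sup>2 - a0 * a2) * g0) :: int)"
    define hd where "hd = (\<lambda>(a0, a1, a2, g0, g1, g2::int). (a0, a1, a2, g0, g1 :: int) :: int \<times> int \<times> int \<times> int \<times> int)"
    define I where "I = {v \<in> box5 n. M v \<noteq> 0}"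
    have finI: "finite I" by (rule finite_subset[OF _ finite_box5[of n]]) (auto simp: I_def)
    have "\<exists>h k. hd x \<in> I \<and> h * k = M (hd x) \<and> h + k = 2 * U x" if x: "x \<in> tangent n" for x
    proof -
      obtain a0 a1 a2 g0 g1 g2 where xe: "x = (a0, a1, a2, g0, g1, g2)" by (cases x) auto
      obtain r s where rs: "s \<noteq> 0" "coprime r s" "tangency a0 a1 a2 g0 g1 g2 r s = 0"
        using x by (auto simp: tangent_def xe)
      obtain z where z: "(U x - a0 * z) * (U x + a0 * z) = M (hd x)"
        using tangent_factorisation[OF rs] unfolding U_def M_def xe hd_def by auto
      have "hd x \<in> I"
        using x by (auto simp: tangent_def exceptional_def ends_box_def box5_def I_def M_def hd_def xe algebra_simps)
      then show ?thesis using z by (intro exI[of _ "U x - a0 * z"] exI[of _ "U x + a0 * z"]) simp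
    qed
    then obtain h k where hk: "\<And>x. x \<in> tangent n \<Longrightarrow> hd x \<in> I \<and> h x * k x = M (hd x) \<and> h x + k x = 2 * U x"
      by metis
    have "card (tangent n) \<le> card (SIGMA v:I. {d. d dvd M v})"
    proof (rule card_inj_on_le)
      show "inj_on (\<lambda>x. (hd x, h x)) (tangent n)"
      proof (rule inj_onI)
        fix x y assume xy: "x \<in> tangent n" "y \<in> tangent n" "(hd x, h x) = (hd y, h y)"
        have "M (hd x) \<noteq> 0" using hk[OF xy(1)] by (auto simp: I_def)
        then have "h x \<noteq> 0" using hk[OF xy(1)] by auto
        moreover have "h x * k x = h x * k y" using hk[OF xy(1)] hk[OF xy(2)] xy(3) by auto
        ultimately have "U x = U y" using hk[OF xy(1)] hk[OF xy(2)] xy(3) by auto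
        moreover obtain a0 a1 a2 g0 g1 g2 g2' where e: "x = (a0, a1, a2, g0, g1, g2)" "y = (a0, a1, a2, g0, g1, g2')"
          using xy(3) by (cases x; cases y) (auto simp: hd_def)
        moreover have "a0 \<noteq> 0" using xy(1) by (auto simp: tangent_def exceptional_def e)
        ultimately show "x = y" by (simp add: U_def)
      qed
      show "(\<lambda>x. (hd x, h x)) ` tangent n \<subseteq> (SIGMA v:I. {d. d dvd M v})"
      proof (rule image_subsetI)
        fix x assume "x \<in> tangent n"
        then have "hd x \<in> I" "h x dvd M (hd x)" using hk by (blast, metis dvd_triv_left)
        then show "(hd x, h x) \<in> (SIGMA v:I. {d. d dvd M v})" by simp
      qed
      show "finite (SIGMA v:I. {d. d dvd M v})"
        using finI by (intro finite_SigmaI finite_divisors_int) (auto simp: I_def)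
    qed
    then have "real (card (tangent n)) \<le> real (card (SIGMA v:I. {d. d dvd M v}))" by simp
    also have "\<dots> \<le> real (card I) * (c * real n powr \<epsilon>)"
    proof (rule card_Sigma_le[OF finI])
      fix v assume v: "v \<in> I"
      then have M: "M v \<noteq> 0" by (simp add: I_def)
      then show "finite {d. d dvd M v}" by (rule finite_divisors_int)
      have "\<bar>M v\<bar> \<le> 32 * int n ^ 6"
      proof -
        obtain a0 a1 a2 g0 g1 where e: "v = (a0, a1, a2, g0, g1)" by (cases v) auto
        have b: "a0 \<in> symm_ints n" "a1 \<in> symm_ints n" "a2 \<in> symm_ints n" "g0 \<in> symm_ints n" "g1 \<in> symm_ints n"
          using v by (auto simp: I_def e box5_def)
        have 1: "\<bar>a1\<^sup>2 - a0 * a2\<bar> \<le> 2 * (int n)\<^sup>2"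
          using abs_mult_le_square[OF b(2) b(2)] abs_mult_le_square[OF b(1) b(3)]
          unfolding power2_eq_square by linarith
        have 2: "\<bar>a1 * g0 + a0 * g1\<bar> \<le> 2 * (int n)\<^sup>2"
          using abs_mult_le_square[OF b(2) b(4)] abs_mult_le_square[OF b(1) b(5)] by linarith
        have "\<bar>M v\<bar> = 4 * (\<bar>a1\<^sup>2 - a0 * a2\<bar> * \<bar>a1 * g0 + a0 * g1\<bar>\<^sup>2)"
          unfolding M_def e by (simp only: case_prod_conv abs_mult power_abs abs_numeral mult.assoc)
        also have "\<dots> \<le> 4 * ((2 * (int n)\<^sup>2) * (2 * (int n)\<^sup>2)\<^sup>2)"
          using 1 2 by (intro mult_left_mono mult_mono power_mono) auto
        also have "\<dots> = 32 * int n ^ 6" by (simp add: power_mult_distrib power_mult[symmetric] power_add[symmetric])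
        finally show ?thesis .
      qed
      then have "real (card {d. d dvd M v}) \<le> D * (real_of_int 32 powr (\<epsilon> / 6) * real n powr (real 6 * (\<epsilon> / 6)))"
        using D assms n M by (intro card_divisors_square_le) auto
      then show "real (card {d. d dvd M v}) \<le> c * real n powr \<epsilon>" by (simp add: c_def mult_ac)
    qed
    also have "\<dots> \<le> (243 * real n ^ 5) * (c * real n powr \<epsilon>)"
    proof (rule mult_right_mono)
      have "card I \<le> card (box5 n)" by (intro card_mono finite_box5) (auto simp: I_def)
      then show "real (card I) \<le> 243 * real n ^ 5" using card_box5_le[OF n] by linarith
    qed (use D in \<open>simp add: c_def\<close>)
    also have "\<dots> = 243 * c * real n powr (5 + \<epsilon>)"
      using n by (simp add: powr_add mult_ac)
    finally show "real (card (tangent n)) \<le> 243 * c * real n powr (5 + \<epsilon>)" .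
  qed
qed

section \<open>Counting the forms with a rational root\<close>

definition rooted :: "nat \<Rightarrow> (ends \<times> int \<times> int \<times> int) set"
  where "rooted n = {((a0, a1, a2, g0, g1, g2), p, t, w) \<in>
      ends_box n \<times> symm_ints n \<times> symm_ints n \<times> symm_ints n.
    pairing a0 a1 a2 g0 g1 g2 + 2 * (p * w + t\<^sup>2) = 0 \<and>
    (\<exists>r s. coprime r s \<and> root_poly a0 a1 a2 g0 g1 g2 p t w r s = 0)}"

text \<open>The terms quadratic in \<open>(p, t, w)\<close> are
  \<open>4 * (p * w + t ^ 2) * r ^ 2 * s ^ 2\<close>. The hypothesis turns them into
  \<open>-2\<close> times the pairing term, and the expansion contributes it once more with
  coefficient \<open>-1\<close>.\<close>

lemma root_poly_eq:
  assumes "pairing a0 a1 a2 g0 g1 g2 + 2 * (p * w + t\<^sup>2) = (0::int)"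
  shows "root_poly a0 a1 a2 g0 g1 g2 p t w r s =
    r ^ 4 * (a1\<^sup>2 - a0 * a2) + s ^ 4 * (g1\<^sup>2 - g0 * g2) +
    r * s * (- 2 * (a2 * r\<^sup>2 + g2 * s\<^sup>2) * p + 4 * (g1 * s\<^sup>2 - a1 * r\<^sup>2) * t + 2 * (a0 * r\<^sup>2 + g0 * s\<^sup>2) * w)
    - 3 * pairing a0 a1 a2 g0 g1 g2 * r\<^sup>2 * s\<^sup>2"
  using assms unfolding root_poly_def pairing_def by Groebner_Basis.algebra

text \<open>This is the rational root theorem for a binary quartic with outer coefficients
  \<open>d0\<close> and \<open>d4\<close>.\<close>

lemma root_dvd:
  assumes "pairing a0 a1 a2 g0 g1 g2 + 2 * (p * w + t\<^sup>2) = (0::int)"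
    and "coprime r s" "root_poly a0 a1 a2 g0 g1 g2 p t w r s = 0"
  shows "r dvd g1\<^sup>2 - g0 * g2" "s dvd a1\<^sup>2 - a0 * a2"
proof -
  define d0 d4 N l where "d0 = a1\<^sup>2 - a0 * a2" and "d4 = g1\<^sup>2 - g0 * g2"
    and "N = pairing a0 a1 a2 g0 g1 g2"
    and "l = - 2 * (a2 * r\<^sup>2 + g2 * s\<^sup>2) * p + 4 * (g1 * s\<^sup>2 - a1 * r\<^sup>2) * t + 2 * (a0 * r\<^sup>2 + g0 * s\<^sup>2) * w"
  have e: "r ^ 4 * d0 + s ^ 4 * d4 + r * s * l - 3 * N * r\<^sup>2 * s\<^sup>2 = 0"
    using root_poly_eq[OF assms(1), of r s] assms(3) unfolding d0_def d4_def N_def l_def by simp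
  have "s ^ 4 * d4 = r * (3 * N * r * s\<^sup>2 - s * l - r ^ 3 * d0)"
    using e by Groebner_Basis.algebra
  then have "r dvd s ^ 4 * d4" by (metis dvd_triv_left)
  then show "r dvd g1\<^sup>2 - g0 * g2" using assms(2) by (simp add: coprime_dvd_mult_right_iff d4_def)
  have "r ^ 4 * d0 = s * (3 * N * r\<^sup>2 * s - r * l - s ^ 3 * d4)"
    using e by Groebner_Basis.algebra
  then have "s dvd r ^ 4 * d0" by (metis dvd_triv_left)
  then show "s dvd a1\<^sup>2 - a0 * a2"
    using assms(2) by (simp add: coprime_dvd_mult_right_iff coprime_commute d0_def)
qed

text \<open>
  The root condition is linear in \<open>(p, t, w)\<close> once the quadratic condition is used, and the resulting
  plane touches the quadric \<open>p w + t\<^sup>2 = m\<close> exactly when the tangency form vanishes.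
\<close>
lemma card_fibre_le:
  obtains K where "K \<ge> 0"
    "\<And>n a0 a1 a2 g0 g1 g2 r s. \<lbrakk>n > 0; r \<noteq> 0; s \<noteq> 0; tangency a0 a1 a2 g0 g1 g2 r s \<noteq> 0\<rbrakk> \<Longrightarrow>
       real (card {(p, t, w) \<in> symm_ints n \<times> symm_ints n \<times> symm_ints n.
          pairing a0 a1 a2 g0 g1 g2 + 2 * (p * w + t\<^sup>2) = 0 \<and> root_poly a0 a1 a2 g0 g1 g2 p t w r s = 0})
       \<le> K * real n powr (2 / 3)"
proof -
  obtain K where K: "K \<ge> 0"
    "\<And>n A B C k m. \<lbrakk>n > 0; m * (B\<^sup>2 + 4 * A * C) \<noteq> k\<^sup>2\<rbrakk> \<Longrightarrow>
       real (card {(p, t, w) \<in> quadric_pts n m. A * p + B * t + C * w = k}) \<le> K * real n powr (2 / 3)"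
    by (rule card_plane_section_le) (rule that; blast)
  show ?thesis
  proof (rule that[OF K(1)])
    fix n :: nat and a0 a1 a2 g0 g1 g2 r s :: int
    assume n: "n > 0" and rs: "r \<noteq> 0" "s \<noteq> 0" and tg: "tangency a0 a1 a2 g0 g1 g2 r s \<noteq> 0"
    define N d0 d4 where "N = pairing a0 a1 a2 g0 g1 g2" and "d0 = a1\<^sup>2 - a0 * a2" and "d4 = g1\<^sup>2 - g0 * g2"
    define A B C where "A = - 2 * (a2 * r\<^sup>2 + g2 * s\<^sup>2)" and "B = 4 * (g1 * s\<^sup>2 - a1 * r\<^sup>2)"
      and "C = 2 * (a0 * r\<^sup>2 + g0 * s\<^sup>2)"
    define S where "S = {(p, t, w) \<in> symm_ints n \<times> symm_ints n \<times> symm_ints n.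
      N + 2 * (p * w + t\<^sup>2) = 0 \<and> root_poly a0 a1 a2 g0 g1 g2 p t w r s = 0}"
    have root: "r * s * (A * p + B * t + C * w) = 3 * N * r\<^sup>2 * s\<^sup>2 - r ^ 4 * d0 - s ^ 4 * d4"
      if "(p, t, w) \<in> S" for p t w
      using that root_poly_eq[of a0 a1 a2 g0 g1 g2 p w t r s]
      by (simp add: S_def N_def A_def B_def C_def d0_def d4_def)
    have "real (card S) \<le> K * real n powr (2 / 3)"
    proof (cases "S = {}")
      case True
      then show ?thesis using K(1) by simp
    next
      case False
      then obtain p0 t0 w0 where S0: "(p0, t0, w0) \<in> S" by auto
      \<comment> \<open>Reading \<open>m\<close> and \<open>k\<close> off a point of the fibre
        avoids dividing by 2 and by \<open>r * s\<close>.\<close>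
      define m k where "m = p0 * w0 + t0\<^sup>2" and "k = A * p0 + B * t0 + C * w0"
      have N: "N = - 2 * m" using S0 by (simp add: S_def m_def)
      have E: "B\<^sup>2 + 4 * A * C = 16 * (r ^ 4 * d0 + s ^ 4 * d4 - N * r\<^sup>2 * s\<^sup>2)"
        unfolding A_def B_def C_def d0_def d4_def N_def pairing_def by Groebner_Basis.algebra
      \<comment> \<open>Up to the factor \<open>r ^ 2 * s ^ 2\<close>, the quantity that must not
        vanish is minus the square of the tangency form.\<close>
      have "r\<^sup>2 * s\<^sup>2 * (m * (B\<^sup>2 + 4 * A * C) - k\<^sup>2) = - ((r ^ 4 * d0 + s ^ 4 * d4 + N * r\<^sup>2 * s\<^sup>2)\<^sup>2)"
        using root[OF S0, folded k_def] unfolding E N by Groebner_Basis.algebra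
      moreover have "r ^ 4 * d0 + s ^ 4 * d4 + N * r\<^sup>2 * s\<^sup>2 \<noteq> 0"
        using tg by (simp add: tangency_def d0_def d4_def N_def)
      ultimately have nondeg: "m * (B\<^sup>2 + 4 * A * C) \<noteq> k\<^sup>2" by auto
      have "S \<subseteq> {(p, t, w) \<in> quadric_pts n m. A * p + B * t + C * w = k}"
      proof (rule subrelI)
        fix p q assume pq: "(p, q) \<in> S"
        obtain t w where q: "q = (t, w)" by force
        have "r * s * (A * p + B * t + C * w) = r * s * k"
          using root[OF S0] root[OF pq[unfolded q]] by (simp add: k_def)
        then have "A * p + B * t + C * w = k" using rs by simp
        moreover have "(p, t, w) \<in> quadric_pts n m"
          using pq N by (simp add: S_def quadric_pts_def q)
        ultimately show "(p, q) \<in> {(p, t, w) \<in> quadric_pts n m. A * p + B * t + C * w = k}"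
          by (simp add: q)
      qed
      moreover have "finite {(p, t, w) \<in> quadric_pts n m. A * p + B * t + C * w = k}"
        by (rule finite_subset[OF _ finite_quadric_pts[of n m]]) auto
      ultimately have "card S \<le> card {(p, t, w) \<in> quadric_pts n m. A * p + B * t + C * w = k}"
        by (rule card_mono[rotated])
      then show ?thesis using K(2)[OF n nondeg] by linarith
    qed
    then show "real (card {(p, t, w) \<in> symm_ints n \<times> symm_ints n \<times> symm_ints n.
          pairing a0 a1 a2 g0 g1 g2 + 2 * (p * w + t\<^sup>2) = 0 \<and> root_poly a0 a1 a2 g0 g1 g2 p t w r s = 0})
       \<le> K * real n powr (2 / 3)"
      by (simp add: S_def N_def)
  qed
qed

lemma abs_diff_mult_le:
  assumes "x \<in> symm_ints n" "y \<in> symm_ints n" "z \<in> symm_ints n"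
  shows "\<bar>y\<^sup>2 - x * z\<bar> \<le> 2 * int n ^ 2"
  using abs_mult_le_square[OF assms(2,2)] abs_mult_le_square[OF assms(1,3)]
  unfolding power2_eq_square by linarith

text \<open>Exceptional and tangent tuples number about \<open>n ^ 5\<close>, and each has at most
  about \<open>n\<close> completions. Each of the other \<open>n ^ 6\<close> tuples admits few pairs
  \<open>(r, s)\<close> by the divisor bound, and each pair allows \<open>n powr (2 / 3)\<close>
  completions.\<close>

lemma card_rooted_le:
  fixes \<epsilon> :: real
  assumes "\<epsilon> > 0"
  obtains K where "K \<ge> 0" "\<And>n. n > 0 \<Longrightarrow> real (card (rooted n)) \<le> K * real n powr (20 / 3 + \<epsilon>)"
proof -
  obtain K1 where K1: "K1 \<ge> 0" "\<And>n m. n > 0 \<Longrightarrow> real (card (quadric_pts n m)) \<le> K1 * real n powr (1 + \<epsilon> / 2)"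
    using card_quadric_pts_le[of "\<epsilon> / 2"] assms by auto
  obtain K2 where K2: "K2 \<ge> 0" "\<And>n. n > 0 \<Longrightarrow> real (card (tangent n)) \<le> K2 * real n powr (5 + \<epsilon> / 2)"
    using card_tangent_le[of "\<epsilon> / 2"] assms by auto
  obtain K3 where K3: "K3 \<ge> 0"
    "\<And>n a0 a1 a2 g0 g1 g2 r s. \<lbrakk>n > 0; r \<noteq> 0; s \<noteq> 0; tangency a0 a1 a2 g0 g1 g2 r s \<noteq> 0\<rbrakk> \<Longrightarrow>
       real (card {(p, t, w) \<in> symm_ints n \<times> symm_ints n \<times> symm_ints n.
          pairing a0 a1 a2 g0 g1 g2 + 2 * (p * w + t\<^sup>2) = 0 \<and> root_poly a0 a1 a2 g0 g1 g2 p t w r s = 0})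
       \<le> K3 * real n powr (2 / 3)"
    by (rule card_fibre_le) (rule that; blast)
  obtain D where D: "D \<ge> 1" "\<And>a::int. a \<noteq> 0 \<Longrightarrow> real (card {d. d dvd a}) \<le> D * \<bar>real_of_int a\<bar> powr (\<epsilon> / 4)"
    using divisor_bound_int[of "\<epsilon> / 4"] assms by auto
  define c where "c = D * 2 powr (\<epsilon> / 4)"
  have c: "c \<ge> 0" using D by (simp add: c_def)
  show ?thesis
  proof (rule that)
    show "(1215 + K2) * K1 + 729 * c\<^sup>2 * K3 \<ge> 0" using K1 K2 K3 c by simp
    fix n :: nat assume n: "n > 0"
    define fib where "fib = (\<lambda>(a0, a1, a2, g0, g1, g2). quadric_pts n (- pairing a0 a1 a2 g0 g1 g2 div 2))"
    define T where "T = (SIGMA x:exceptional n \<union> tangent n. fib x)"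
    have fin: "finite (exceptional n)" "finite (tangent n)"
      by (rule finite_subset[OF _ finite_ends_box[of n]], force simp: exceptional_def tangent_def)+
    have finT: "finite T" unfolding T_def
      using fin by (intro finite_SigmaI) (auto simp: fib_def finite_quadric_pts split: prod.splits)
    have T: "real (card T) \<le> (1215 + K2) * K1 * real n powr (20 / 3 + \<epsilon>)"
    proof -
      have "real (card T) \<le> real (card (exceptional n \<union> tangent n)) * (K1 * real n powr (1 + \<epsilon> / 2))"
        unfolding T_def using fin K1(2)[OF n]
        by (intro card_Sigma_le) (auto simp: fib_def finite_quadric_pts split: prod.splits)
      also have "\<dots> \<le> ((1215 + K2) * real n powr (5 + \<epsilon> / 2)) * (K1 * real n powr (1 + \<epsilon> / 2))"
      proof (rule mult_right_mono)
        have "real (card (exceptional n \<union> tangent n)) \<le> real (card (exceptional n)) + real (card (tangent n))"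
          using card_Un_le[of "exceptional n" "tangent n"] by linarith
        also have "real (card (exceptional n)) \<le> 1215 * real n powr (5 + \<epsilon> / 2)"
        proof -
          have "real n powr 5 \<le> real n powr (5 + \<epsilon> / 2)" using n assms by (intro powr_mono) auto
          then show ?thesis using card_exceptional_le[OF n] n by simp
        qed
        also note K2(2)[OF n]
        finally show "real (card (exceptional n \<union> tangent n)) \<le> (1215 + K2) * real n powr (5 + \<epsilon> / 2)"
          by (simp add: distrib_right)
      qed (use K1 in simp)
      also have "\<dots> = (1215 + K2) * K1 * real n powr (6 + \<epsilon>)"
        by (simp add: powr_add[symmetric] mult_ac)
      also have "\<dots> \<le> (1215 + K2) * K1 * real n powr (20 / 3 + \<epsilon>)"
        using n K1 K2 by (intro mult_left_mono powr_mono) auto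
      finally show ?thesis .
    qed
    define d0 d4 where "d0 = (\<lambda>(a0, a1, a2, g0::int, g1::int, g2::int). a1\<^sup>2 - a0 * a2 :: int)"
      and "d4 = (\<lambda>(a0::int, a1::int, a2::int, g0, g1, g2). g1\<^sup>2 - g0 * g2 :: int)"
    define X where "X = (SIGMA x:{x \<in> ends_box n. d0 x \<noteq> 0 \<and> d4 x \<noteq> 0}. {r. r dvd d4 x} \<times> {s. s dvd d0 x})"
    \<comment> \<open>With tangency excluded inside \<open>F\<close>, the fibre is empty for a
      tangent pair, so the conic bound holds over every element of \<open>X\<close>.\<close>
    define F where "F = (\<lambda>((a0, a1, a2, g0, g1, g2), r, s).
      {(p, t, w) \<in> symm_ints n \<times> symm_ints n \<times> symm_ints n. tangency a0 a1 a2 g0 g1 g2 r s \<noteq> 0 \<and>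
          pairing a0 a1 a2 g0 g1 g2 + 2 * (p * w + t\<^sup>2) = 0 \<and> root_poly a0 a1 a2 g0 g1 g2 p t w r s = 0})"
    have finF: "finite (F v)" for v
      by (rule finite_subset[of _ "symm_ints n \<times> symm_ints n \<times> symm_ints n"])
        (auto simp: F_def split: prod.splits)
    have divs: "real (card {d. d dvd e}) \<le> c * real n powr (\<epsilon> / 2)"
      if "e \<noteq> 0" "\<bar>e\<bar> \<le> 2 * int n ^ 2" for e
    proof -
      have "real (card {d. d dvd e}) \<le> D * (real_of_int 2 powr (\<epsilon> / 4) * real n powr (real 2 * (\<epsilon> / 4)))"
        using D assms n that by (intro card_divisors_square_le) auto
      then show ?thesis by (simp add: c_def mult_ac)
    qed
    have finX: "finite X" unfolding X_def
      using finite_ends_box by (intro finite_SigmaI finite_cartesian_product finite_divisors_int) auto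
    have X: "real (card X) \<le> 729 * c\<^sup>2 * real n powr (6 + \<epsilon>)"
    proof -
      have "real (card X) \<le> real (card {x \<in> ends_box n. d0 x \<noteq> 0 \<and> d4 x \<noteq> 0}) *
        ((c * real n powr (\<epsilon> / 2)) * (c * real n powr (\<epsilon> / 2)))"
        unfolding X_def
      proof (rule card_Sigma_le)
        show "finite {x \<in> ends_box n. d0 x \<noteq> 0 \<and> d4 x \<noteq> 0}" using finite_ends_box by simp
        fix x assume x: "x \<in> {x \<in> ends_box n. d0 x \<noteq> 0 \<and> d4 x \<noteq> 0}"
        then show "finite ({r. r dvd d4 x} \<times> {s. s dvd d0 x})"
          by (intro finite_cartesian_product finite_divisors_int) auto
        have "\<bar>d0 x\<bar> \<le> 2 * int n ^ 2" "\<bar>d4 x\<bar> \<le> 2 * int n ^ 2"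
          using x abs_diff_mult_le by (auto simp: d0_def d4_def ends_box_def split: prod.splits)
        then show "real (card ({r. r dvd d4 x} \<times> {s. s dvd d0 x})) \<le>
          (c * real n powr (\<epsilon> / 2)) * (c * real n powr (\<epsilon> / 2))"
          unfolding card_cartesian_product of_nat_mult using x divs c by (intro mult_mono) auto
      qed
      also have "\<dots> \<le> (729 * real n ^ 6) * ((c * real n powr (\<epsilon> / 2)) * (c * real n powr (\<epsilon> / 2)))"
      proof (rule mult_right_mono)
        have "card {x \<in> ends_box n. d0 x \<noteq> 0 \<and> d4 x \<noteq> 0} \<le> card (ends_box n)"
          using finite_ends_box by (intro card_mono) auto
        then show "real (card {x \<in> ends_box n. d0 x \<noteq> 0 \<and> d4 x \<noteq> 0}) \<le> 729 * real n ^ 6"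
          using card_ends_box_le[OF n] by linarith
      qed (use c in simp)
      also have "\<dots> = 729 * c\<^sup>2 * (real n ^ 6 * real n powr (\<epsilon> / 2 + \<epsilon> / 2))"
        by (simp only: powr_add power2_eq_square mult_ac)
      also have "\<dots> = 729 * c\<^sup>2 * real n powr (6 + \<epsilon>)"
        using n by (simp add: powr_add)
      finally show ?thesis .
    qed
    have XF: "real (card (Sigma X F)) \<le> 729 * c\<^sup>2 * K3 * real n powr (20 / 3 + \<epsilon>)"
    proof -
      have "real (card (Sigma X F)) \<le> real (card X) * (K3 * real n powr (2 / 3))"
      proof (rule card_Sigma_le[OF finX finF])
        fix v assume v: "v \<in> X"
        obtain a0 a1 a2 g0 g1 g2 r s where e: "v = ((a0, a1, a2, g0, g1, g2), r, s)" by (cases v) auto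
        have "r \<noteq> 0" "s \<noteq> 0" using v by (auto simp: X_def e)
        then show "real (card (F v)) \<le> K3 * real n powr (2 / 3)"
          using K3(2)[OF n, of r s a0 a1 a2 g0 g1 g2] K3(1)
          by (cases "tangency a0 a1 a2 g0 g1 g2 r s = 0") (auto simp: F_def e)
      qed
      also have "\<dots> \<le> (729 * c\<^sup>2 * real n powr (6 + \<epsilon>)) * (K3 * real n powr (2 / 3))"
        using X K3 by (intro mult_right_mono) auto
      also have "\<dots> = 729 * c\<^sup>2 * K3 * real n powr ((6 + \<epsilon>) + 2 / 3)"
        by (simp only: powr_add mult_ac)
      finally show ?thesis by (simp add: algebra_simps)
    qed
    \<comment> \<open>The image forgets \<open>(r, s)\<close>; a form with several roots is counted
      once for each of them, which is harmless for an upper bound.\<close>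
    have "rooted n \<subseteq> T \<union> (\<lambda>((x, r, s), y). (x, y)) ` Sigma X F"
    proof
      fix v assume v: "v \<in> rooted n"
      obtain a0 a1 a2 g0 g1 g2 p t w where e: "v = ((a0, a1, a2, g0, g1, g2), p, t, w)" by (cases v) auto
      define x where "x = (a0, a1, a2, g0, g1, g2)"
      have x: "x \<in> ends_box n" and y: "(p, t, w) \<in> symm_ints n \<times> symm_ints n \<times> symm_ints n"
        and q: "pairing a0 a1 a2 g0 g1 g2 + 2 * (p * w + t\<^sup>2) = 0"
        using v by (auto simp: rooted_def e x_def)
      obtain r s where rs: "coprime r s" "root_poly a0 a1 a2 g0 g1 g2 p t w r s = 0"
        using v by (auto simp: rooted_def e)
      show "v \<in> T \<union> (\<lambda>((x, r, s), y). (x, y)) ` Sigma X F"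
      proof (cases "x \<in> exceptional n \<union> tangent n")
        case True
        have "- pairing a0 a1 a2 g0 g1 g2 div 2 = p * w + t\<^sup>2" using q by simp
        then have "(p, t, w) \<in> fib x" using y by (simp add: fib_def x_def quadric_pts_def)
        then show ?thesis using True by (simp add: T_def e x_def)
      next
        case False
        then have nz: "d0 x \<noteq> 0" "d4 x \<noteq> 0"
          using x by (auto simp: exceptional_def x_def d0_def d4_def)
        have dv: "r dvd d4 x" "s dvd d0 x" using root_dvd[OF q rs] by (simp_all add: x_def d0_def d4_def)
        then have "s \<noteq> 0" using nz by auto
        then have "tangency a0 a1 a2 g0 g1 g2 r s \<noteq> 0"
          using False x rs(1) by (auto simp: tangent_def x_def)
        then have "(p, t, w) \<in> F (x, r, s)" using y q rs by (simp add: F_def x_def)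
        moreover have "(x, r, s) \<in> X" using x nz dv by (simp add: X_def)
        ultimately have "((x, r, s), p, t, w) \<in> Sigma X F" by simp
        then have "(\<lambda>((x, r, s), y). (x, y)) ((x, r, s), p, t, w) \<in> (\<lambda>((x, r, s), y). (x, y)) ` Sigma X F"
          by (rule imageI)
        then show ?thesis by (simp add: e x_def)
      qed
    qed
    then have "card (rooted n) \<le> card (T \<union> (\<lambda>((x, r, s), y). (x, y)) ` Sigma X F)"
      using finT finX finF by (intro card_mono) auto
    also have "\<dots> \<le> card T + card ((\<lambda>((x, r, s), y). (x, y)) ` Sigma X F)" by (rule card_Un_le)
    also have "\<dots> \<le> card T + card (Sigma X F)"
      using finX finF by (intro add_left_mono card_image_le) auto
    finally have "real (card (rooted n)) \<le> real (card T) + real (card (Sigma X F))" by linarith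
    then show "real (card (rooted n)) \<le> ((1215 + K2) * K1 + 729 * c\<^sup>2 * K3) * real n powr (20 / 3 + \<epsilon>)"
      using T XF by (simp add: distrib_right)
  qed
qed

section \<open>Distinguished matrices\<close>

lemma map_root_poly:
  "root_poly (of_int a0) (of_int a1) (of_int a2) (of_int g0) (of_int g1) (of_int g2) (of_int p) (of_int t) (of_int w)
     (of_int r) (of_int s) = (of_int (root_poly a0 a1 a2 g0 g1 g2 p t w r s) :: 'a::comm_ring_1)"
  by (simp add: root_poly_def)

lemma root_poly_scale:
  "root_poly a0 a1 a2 g0 g1 g2 p t w (c * r) (c * s) = c ^ 4 * root_poly a0 a1 a2 g0 g1 g2 p t w r s"
  for a0 :: rat
  unfolding root_poly_def by Groebner_Basis.algebra

lemma coprime_representative: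
  fixes x y :: rat
  assumes "x \<noteq> 0 \<or> y \<noteq> 0"
  obtains c :: rat and r s :: int where "c \<noteq> 0" "coprime r s" "x = c * of_int r" "y = c * of_int s"
proof -
  obtain a b where ab: "quotient_of x = (a, b)" by force
  obtain a' b' where ab': "quotient_of y = (a', b')" by force
  have b: "b > 0" "b' > 0" using ab ab' quotient_of_denom_pos by auto
  have xy: "x = of_int a / of_int b" "y = of_int a' / of_int b'"
    using ab ab' quotient_of_div by auto
  define g where "g = gcd (a * b') (a' * b)"
  have "a * b' \<noteq> 0 \<or> a' * b \<noteq> 0" using assms xy b by auto
  then obtain r s where rs: "a * b' = r * g" "a' * b = s * g" "coprime r s"
    unfolding g_def by (metis gcd_coprime_exists gcd_eq_0_iff)
  have "g \<noteq> 0" using \<open>a * b' \<noteq> 0 \<or> a' * b \<noteq> 0\<close> by (auto simp: g_def)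
  show ?thesis
  proof (rule that)
    show "(of_int g / (of_int b * of_int b') :: rat) \<noteq> 0" using \<open>g \<noteq> 0\<close> b by simp
    show "coprime r s" by (rule rs)
    have "of_int a * of_int b' = (of_int r * of_int g :: rat)" "of_int a' * of_int b = (of_int s * of_int g :: rat)"
      using rs by (metis of_int_mult)+
    moreover have "x * of_int b = of_int a" "y * of_int b' = of_int a'" using b xy by simp_all
    ultimately have "x * (of_int b' * of_int b) = of_int g * of_int r" "y * (of_int b' * of_int b) = of_int g * of_int s"
      by Groebner_Basis.algebra+
    then show "x = of_int g / (of_int b * of_int b') * of_int r" "y = of_int g / (of_int b * of_int b') * of_int s"
      using b by (simp_all add: field_simps)
  qed
qed

text \<open>The matrix with rows \<open>(v1, v2)\<close> and \<open>(v3, - v4)\<close> has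
  determinant zero, so it is an outer product.\<close>

lemma isotropic_split:
  fixes v1 v2 v3 v4 :: "'a::field"
  assumes "v1 * v4 + v2 * v3 = 0"
  obtains x0 x1 y0 y1 where "v1 = x0 * y0" "v2 = x0 * y1" "v3 = x1 * y0" "v4 = - (x1 * y1)"
proof (cases "v1 = 0")
  case False
  have "v4 = - (v3 / v1 * v2)" using assms False by (simp add: field_simps add_eq_0_iff)
  then show ?thesis using that[of 1 v1 v2 "v3 / v1"] False by simp
next
  case True
  show ?thesis
  proof (cases "v2 = 0")
    case True
    then show ?thesis using that[of 0 v3 "- v4" 1] \<open>v1 = 0\<close> by simp
  next
    case False
    then show ?thesis using that[of v2 0 1 "- v4"] True assms by simp
  qed
qed

definition polar_form ::
    "'a \<Rightarrow> 'a \<Rightarrow> 'a \<Rightarrow> 'a \<Rightarrow> 'a \<Rightarrow> 'a \<Rightarrow> 'a \<Rightarrow> 'a \<Rightarrow> 'a \<Rightarrow> 'a \<times> 'a \<times> 'a \<times> 'a \<Rightarrow> 'a \<times> 'a \<times> 'a \<times> 'a \<Rightarrow> 'a::comm_ring_1"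
  where "polar_form a0 a1 a2 g0 g1 g2 p t w = (\<lambda>(v1, v2, v3, v4) (w1, w2, w3, w4).
    a0 * v1 * w1 + a2 * v2 * w2 + g0 * v3 * w3 + g2 * v4 * w4
    + a1 * (v1 * w2 + v2 * w1) + p * (v1 * w3 + v3 * w1) + t * (v1 * w4 + v4 * w1 - v2 * w3 - v3 * w2)
    + w * (v2 * w4 + v4 * w2) + g1 * (v3 * w4 + v4 * w3))"

text \<open>Exchanging the second and third coordinates transposes the outer product and so
  interchanges \<open>x\<close> and \<open>y\<close>. This reduces one ruling to the other.\<close>

lemma polar_form_swap:
  "polar_form a0 p g0 a2 w g2 a1 t g1 (v1, v3, v2, v4) (w1, w3, w2, w4) =
   polar_form a0 a1 a2 g0 g1 g2 p t w (v1, v2, v3, v4) (w1, w2, w3, w4)"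
  by (simp add: polar_form_def algebra_simps)

text \<open>
  Restricted to the vectors \<open>x \<otimes> y\<close> with \<open>x\<close> fixed, the form is a binary quadratic form in \<open>y\<close>; the
  hypotheses put a nonzero vector into its radical, and \<open>root_poly\<close> is its discriminant.
\<close>
lemma root_of_ruling:
  fixes a0 :: "'a::field"
  assumes "polar_form a0 a1 a2 g0 g1 g2 p t w (x0 * y0, x0 * y1, x1 * y0, - (x1 * y1)) (x0 * y0, x0 * y1, x1 * y0, - (x1 * y1)) = 0"
    and "polar_form a0 a1 a2 g0 g1 g2 p t w (x0 * y0, x0 * y1, x1 * y0, - (x1 * y1)) (x0 * z0, x0 * z1, x1 * z0, - (x1 * z1)) = 0"
    and det: "y0 * z1 - y1 * z0 \<noteq> 0"
  shows "root_poly a0 a1 a2 g0 g1 g2 p t w x0 x1 = 0"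
proof -
  define Q0 where "Q0 = a0 * x0\<^sup>2 + 2 * p * x0 * x1 + g0 * x1\<^sup>2"
  define Q1 where "Q1 = a1 * x0\<^sup>2 - 2 * t * x0 * x1 - g1 * x1\<^sup>2"
  define Q2 where "Q2 = a2 * x0\<^sup>2 - 2 * w * x0 * x1 + g2 * x1\<^sup>2"
  define u0 u1 where "u0 = Q0 * y0 + Q1 * y1" and "u1 = Q1 * y0 + Q2 * y1"
  have 1: "u0 * y0 + u1 * y1 = 0"
    using assms(1) unfolding u0_def u1_def Q0_def Q1_def Q2_def polar_form_def
    by (simp add: algebra_simps power2_eq_square)
  have 2: "u0 * z0 + u1 * z1 = 0"
    using assms(2) unfolding u0_def u1_def Q0_def Q1_def Q2_def polar_form_def
    by (simp add: algebra_simps power2_eq_square)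
  have "(y0 * z1 - y1 * z0) * u0 = z1 * (u0 * y0 + u1 * y1) - y1 * (u0 * z0 + u1 * z1)"
    by (simp add: algebra_simps)
  then have u0: "u0 = 0" using 1 2 det by simp
  have "(y0 * z1 - y1 * z0) * u1 = y0 * (u0 * z0 + u1 * z1) - z0 * (u0 * y0 + u1 * y1)"
    by (simp add: algebra_simps)
  then have u1: "u1 = 0" using 1 2 det by simp
  \<comment> \<open>The adjugate of the Gram matrix with entries \<open>Q0\<close>,
    \<open>Q1\<close>, \<open>Q2\<close> is applied to its kernel vector
    \<open>(y0, y1)\<close>.\<close>
  have "y0 * (Q1\<^sup>2 - Q0 * Q2) = Q1 * u1 - Q2 * u0" "y1 * (Q1\<^sup>2 - Q0 * Q2) = Q1 * u0 - Q0 * u1"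
    by (simp_all add: u0_def u1_def algebra_simps power2_eq_square)
  then have "Q1\<^sup>2 - Q0 * Q2 = 0" using u0 u1 det by auto
  then show ?thesis by (simp add: root_poly_def Q0_def Q1_def Q2_def)
qed

lemma parallel_scaling:
  fixes x0 x1 z0 z1 :: "'a::field"
  assumes "x0 * z1 = x1 * z0" "x0 \<noteq> 0 \<or> x1 \<noteq> 0"
  obtains c where "z0 = c * x0" "z1 = c * x1"
proof (cases "x0 = 0")
  case True
  then show ?thesis using that[of "z1 / x1"] assms by auto
next
  case False
  then show ?thesis using that[of "z0 / x0"] assms by (auto simp: field_simps)
qed

text \<open>The polar form of \<open>A0\<close> at two outer products is minus the product of the
  determinants of their left and of their right factors. So orthogonal isotropic vectors share one
  factor up to scaling, and the plane they span lies in one of the two rulings.\<close>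

lemma root_of_isotropic_plane:
  fixes a0 :: rat
  assumes v: "v1 * v4 + v2 * v3 = 0" and w: "w1 * w4 + w2 * w3 = 0"
    and vw: "v1 * w4 + v4 * w1 + v2 * w3 + v3 * w2 = 0"
    and ind: "\<And>c. (w1, w2, w3, w4) \<noteq> (c * v1, c * v2, c * v3, c * v4)" "(v1, v2, v3, v4) \<noteq> (0, 0, 0, 0)"
    and F: "polar_form a0 a1 a2 g0 g1 g2 p t w (v1, v2, v3, v4) (v1, v2, v3, v4) = 0"
      "polar_form a0 a1 a2 g0 g1 g2 p t w (v1, v2, v3, v4) (w1, w2, w3, w4) = 0"
  shows "\<exists>x0 x1. (x0 \<noteq> 0 \<or> x1 \<noteq> 0) \<and>
    (root_poly a0 a1 a2 g0 g1 g2 p t w x0 x1 = 0 \<or> root_poly a0 p g0 a2 w g2 a1 t g1 x0 x1 = 0)"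
proof -
  obtain x0 x1 y0 y1 where xy: "v1 = x0 * y0" "v2 = x0 * y1" "v3 = x1 * y0" "v4 = - (x1 * y1)"
    by (rule isotropic_split[OF v])
  obtain z0 z1 u0 u1 where zu: "w1 = z0 * u0" "w2 = z0 * u1" "w3 = z1 * u0" "w4 = - (z1 * u1)"
    by (rule isotropic_split[OF w])
  have nz: "x0 \<noteq> 0 \<or> x1 \<noteq> 0" "y0 \<noteq> 0 \<or> y1 \<noteq> 0" using ind(2) xy by auto
  have "(x0 * z1 - x1 * z0) * (y0 * u1 - y1 * u0) = 0"
    using vw unfolding xy zu by Groebner_Basis.algebra
  then consider "x0 * z1 = x1 * z0" | "y0 * u1 = y1 * u0" by auto
  then show ?thesis
  proof cases
    case 1
    obtain c where c: "z0 = c * x0" "z1 = c * x1" by (rule parallel_scaling[OF 1 nz(1)])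
    \<comment> \<open>If the second factors were parallel too, \<open>w\<close> would be a multiple
      of \<open>v\<close>.\<close>
    have "y0 * (c * u1) - y1 * (c * u0) \<noteq> 0"
    proof
      assume "y0 * (c * u1) - y1 * (c * u0) = 0"
      then have e: "y0 * (c * u1) = y1 * (c * u0)" by simp
      obtain d where d: "c * u0 = d * y0" "c * u1 = d * y1" by (rule parallel_scaling[OF e nz(2)])
      have "w1 = d * v1" "w2 = d * v2" "w3 = d * v3" "w4 = d * v4"
        using d unfolding xy zu c by Groebner_Basis.algebra+
      then show False using ind(1)[of d] by simp
    qed
    then have "root_poly a0 a1 a2 g0 g1 g2 p t w x0 x1 = 0"
      using F unfolding xy zu c by (intro root_of_ruling[of _ _ _ _ _ _ _ _ _ x0 y0 y1 x1 "c * u0" "c * u1"]) (simp_all add: mult_ac)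
    then show ?thesis using nz(1) by blast
  next
    case 2
    obtain c where c: "u0 = c * y0" "u1 = c * y1" by (rule parallel_scaling[OF 2 nz(2)])
    have "x0 * (c * z1) - x1 * (c * z0) \<noteq> 0"
    proof
      assume "x0 * (c * z1) - x1 * (c * z0) = 0"
      then have e: "x0 * (c * z1) = x1 * (c * z0)" by simp
      obtain d where d: "c * z0 = d * x0" "c * z1 = d * x1" by (rule parallel_scaling[OF e nz(1)])
      have "w1 = d * v1" "w2 = d * v2" "w3 = d * v3" "w4 = d * v4"
        using d unfolding xy zu c by Groebner_Basis.algebra+
      then show False using ind(1)[of d] by simp
    qed
    moreover have "polar_form a0 p g0 a2 w g2 a1 t g1 (v1, v3, v2, v4) (v1, v3, v2, v4) = 0"
      "polar_form a0 p g0 a2 w g2 a1 t g1 (v1, v3, v2, v4) (w1, w3, w2, w4) = 0"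
      using F by (simp_all only: polar_form_swap)
    ultimately have "root_poly a0 p g0 a2 w g2 a1 t g1 y0 y1 = 0"
      unfolding xy zu c by (intro root_of_ruling[of _ _ _ _ _ _ _ _ _ y0 x0 x1 y1 "c * z0" "c * z1"]) (simp_all add: mult_ac)
    then show ?thesis using nz(2) by blast
  qed
qed

section \<open>From matrices in \<open>Vspace\<close> to coordinate tuples\<close>

lemma bilin_A0: "bilin A0 v w = v $ 1 * w $ 4 + v $ 4 * w $ 1 + v $ 2 * w $ 3 + v $ 3 * w $ 2"
  by (simp add: bilin_def sum_4 A0_def vector_def)

lemma Vspace_sym: "B \<in> Vspace \<Longrightarrow> B $ j $ i = B $ i $ j"
  by (metis (mono_tags, lifting) Vspace_def mem_Collect_eq transpose_def vec_lambda_beta)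

lemma bilin_Vspace:
  assumes "B \<in> Vspace"
  shows "bilin B v w = polar_form (B $ 1 $ 1) (B $ 1 $ 2) (B $ 2 $ 2) (B $ 3 $ 3) (B $ 3 $ 4) (B $ 4 $ 4)
    (B $ 1 $ 3) (B $ 1 $ 4) (B $ 2 $ 4) (v $ 1, v $ 2, v $ 3, v $ 4) (w $ 1, w $ 2, w $ 3, w $ 4)"
proof -
  have "B $ 2 $ 3 = - (B $ 1 $ 4)" using assms by (simp add: Vspace_def)
  then show ?thesis
    using Vspace_sym[OF assms, of 2 1] Vspace_sym[OF assms, of 3 1] Vspace_sym[OF assms, of 4 1]
      Vspace_sym[OF assms, of 3 2] Vspace_sym[OF assms, of 4 2] Vspace_sym[OF assms, of 4 3]
    by (simp add: bilin_def sum_4 polar_form_def algebra_simps)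
qed

definition tuple_of :: "'a ^ 4 ^ 4 \<Rightarrow> ('a \<times> 'a \<times> 'a \<times> 'a \<times> 'a \<times> 'a) \<times> 'a \<times> 'a \<times> 'a"
  where "tuple_of B = ((B $ 1 $ 1, B $ 1 $ 2, B $ 2 $ 2, B $ 3 $ 3, B $ 3 $ 4, B $ 4 $ 4),
    B $ 1 $ 3, B $ 1 $ 4, B $ 2 $ 4)"

text \<open>The tuple of \<open>B\<close> after exchanging the indices 2 and 3, which covers the
  second ruling.\<close>

definition swapped_tuple_of :: "'a ^ 4 ^ 4 \<Rightarrow> ('a \<times> 'a \<times> 'a \<times> 'a \<times> 'a \<times> 'a) \<times> 'a \<times> 'a \<times> 'a"
  where "swapped_tuple_of B = ((B $ 1 $ 1, B $ 1 $ 3, B $ 3 $ 3, B $ 2 $ 2, B $ 2 $ 4, B $ 4 $ 4),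
    B $ 1 $ 2, B $ 1 $ 4, B $ 3 $ 4)"

lemma Vspace_eqI:
  assumes "B \<in> Vspace" "C \<in> Vspace" "\<And>i j. (i, j) \<in> coords \<Longrightarrow> B $ i $ j = C $ i $ j"
  shows "B = C"
proof -
  have "B $ 2 $ 3 = C $ 2 $ 3" using assms(1,2) assms(3)[of 1 4] by (simp add: Vspace_def coords_def)
  then show ?thesis
    using assms(3) Vspace_sym[OF assms(1)] Vspace_sym[OF assms(2)]
    by (simp add: vec_eq_iff forall_4 coords_def)
qed

lemma inj_tuple_of: "inj_on tuple_of Vspace" "inj_on swapped_tuple_of Vspace"
  by (auto simp: inj_on_def tuple_of_def swapped_tuple_of_def coords_def intro!: Vspace_eqI)

lemma root_of_Q_distinguished:
  assumes B: "B \<in> Vspace" and dist: "Q_distinguished (map_matrix rat_of_int B)"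
  shows "\<exists>r s. coprime r s \<and>
    (root_poly (B $ 1 $ 1) (B $ 1 $ 2) (B $ 2 $ 2) (B $ 3 $ 3) (B $ 3 $ 4) (B $ 4 $ 4)
       (B $ 1 $ 3) (B $ 1 $ 4) (B $ 2 $ 4) r s = 0 \<or>
     root_poly (B $ 1 $ 1) (B $ 1 $ 3) (B $ 3 $ 3) (B $ 2 $ 2) (B $ 2 $ 4) (B $ 4 $ 4)
       (B $ 1 $ 2) (B $ 1 $ 4) (B $ 3 $ 4) r s = 0)"
proof -
  define Q where "Q = map_matrix rat_of_int B"
  have Q: "Q $ i $ j = of_int (B $ i $ j)" for i j by (simp add: Q_def)
  have QV: "Q \<in> Vspace"
    using B Vspace_sym[OF B] by (simp add: Vspace_def vec_eq_iff transpose_def Q)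
  obtain v w where ne: "v \<noteq> w" and ind: "vec.independent {v, w}"
    and A0: "bilin A0 v v = 0" "bilin A0 w w = 0" "bilin A0 v w = 0"
    and B0: "bilin Q v v = 0" "bilin Q v w = 0"
    using dist unfolding Q_distinguished_def Q_def by blast
  have w_ne: "w \<noteq> c *s v" for c
  proof
    assume "w = c *s v"
    then have "w \<in> vec.span {v}" by (simp add: vec.span_base vec.span_scale)
    moreover have "w \<notin> vec.span {v}"
      using ind ne vec.independent_insert[of w "{v}"] by (simp add: insert_commute)
    ultimately show False by simp
  qed
  have v_ne: "v \<noteq> 0" using ind vec.dependent_zero[of "{v, w}"] by auto
  have "\<exists>x0 x1. (x0 \<noteq> 0 \<or> x1 \<noteq> 0) \<and>
    (root_poly (Q $ 1 $ 1) (Q $ 1 $ 2) (Q $ 2 $ 2) (Q $ 3 $ 3) (Q $ 3 $ 4) (Q $ 4 $ 4)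
       (Q $ 1 $ 3) (Q $ 1 $ 4) (Q $ 2 $ 4) x0 x1 = 0 \<or>
     root_poly (Q $ 1 $ 1) (Q $ 1 $ 3) (Q $ 3 $ 3) (Q $ 2 $ 2) (Q $ 2 $ 4) (Q $ 4 $ 4)
       (Q $ 1 $ 2) (Q $ 1 $ 4) (Q $ 3 $ 4) x0 x1 = 0)"
  proof (rule root_of_isotropic_plane)
    show "v $ 1 * v $ 4 + v $ 2 * v $ 3 = 0" "w $ 1 * w $ 4 + w $ 2 * w $ 3 = 0"
      "v $ 1 * w $ 4 + v $ 4 * w $ 1 + v $ 2 * w $ 3 + v $ 3 * w $ 2 = 0"
      using A0 by (simp_all add: bilin_A0 mult_ac)
    show "(w $ 1, w $ 2, w $ 3, w $ 4) \<noteq> (c * v $ 1, c * v $ 2, c * v $ 3, c * v $ 4)" for c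
      using w_ne[of c] by (auto simp: vec_eq_iff forall_4)
    show "(v $ 1, v $ 2, v $ 3, v $ 4) \<noteq> (0, 0, 0, 0)"
      using v_ne by (auto simp: vec_eq_iff forall_4)
  qed (use B0 in \<open>simp_all only: bilin_Vspace[OF QV]\<close>)
  then obtain x0 x1 where x: "x0 \<noteq> 0 \<or> x1 \<noteq> 0"
    and root: "root_poly (Q $ 1 $ 1) (Q $ 1 $ 2) (Q $ 2 $ 2) (Q $ 3 $ 3) (Q $ 3 $ 4) (Q $ 4 $ 4)
       (Q $ 1 $ 3) (Q $ 1 $ 4) (Q $ 2 $ 4) x0 x1 = 0 \<or>
     root_poly (Q $ 1 $ 1) (Q $ 1 $ 3) (Q $ 3 $ 3) (Q $ 2 $ 2) (Q $ 2 $ 4) (Q $ 4 $ 4)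
       (Q $ 1 $ 2) (Q $ 1 $ 4) (Q $ 3 $ 4) x0 x1 = 0" by auto
  \<comment> \<open>\<open>root_poly\<close> is homogeneous of degree 4 in its last two arguments,
    so the rational root may be replaced by a coprime integral one.\<close>
  obtain c and r s :: int where c: "c \<noteq> 0" "coprime r s" "x0 = c * of_int r" "x1 = c * of_int s"
    by (rule coprime_representative[OF x])
  show ?thesis
    using root c(1,2) unfolding c(3,4) Q root_poly_scale map_root_poly by auto
qed

text \<open>One of the two injective encodings sends each counted matrix into \<open>rooted\<close>,
  which gives the factor 2; integral entries bounded by \<open>T\<close> are bounded by its
  floor.\<close>

lemma N_q_dist_le:
  assumes "\<And>i j. (i, j) \<in> coords \<Longrightarrow> Y i j \<le> T" "T \<ge> 0"
  shows "N_q_dist (coord_box Y) \<le> 2 * card (rooted (nat \<lfloor>T\<rfloor>))"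
proof -
  define n where "n = nat \<lfloor>T\<rfloor>"
  define S where "S = {B :: int ^ 4 ^ 4. B \<in> Vspace \<and> map_matrix real_of_int B \<in> coord_box Y \<and>
    qform B = 0 \<and> Delta B \<noteq> 0 \<and> Q_distinguished (map_matrix rat_of_int B)}"
  have fin: "finite (rooted n)"
    by (rule finite_subset[of _ "ends_box n \<times> symm_ints n \<times> symm_ints n \<times> symm_ints n"])
      (auto simp: rooted_def finite_ends_box)
  have cover: "tuple_of B \<in> rooted n \<or> swapped_tuple_of B \<in> rooted n" if B: "B \<in> S" for B
  proof -
    have V: "B \<in> Vspace" and q: "qform B = 0" and d: "Q_distinguished (map_matrix rat_of_int B)"
      and box: "map_matrix real_of_int B \<in> coord_box Y"
      using B by (auto simp: S_def)
    have entry: "B $ i $ j \<in> symm_ints n" if "(i, j) \<in> coords" for i j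
    proof -
      have "\<bar>real_of_int (B $ i $ j)\<bar> \<le> Y i j" using box that by (auto simp: coord_box_def)
      then have "\<bar>real_of_int (B $ i $ j)\<bar> \<le> T" using assms(1)[OF that] by linarith
      then have "\<bar>B $ i $ j\<bar> \<le> \<lfloor>T\<rfloor>" by (simp add: le_floor_iff)
      then show ?thesis using assms(2) by (auto simp: n_def)
    qed
    have e: "B $ 1 $ 1 \<in> symm_ints n" "B $ 1 $ 2 \<in> symm_ints n" "B $ 1 $ 3 \<in> symm_ints n"
      "B $ 1 $ 4 \<in> symm_ints n" "B $ 2 $ 2 \<in> symm_ints n" "B $ 2 $ 4 \<in> symm_ints n"
      "B $ 3 $ 3 \<in> symm_ints n" "B $ 3 $ 4 \<in> symm_ints n" "B $ 4 $ 4 \<in> symm_ints n"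
      by (rule entry, simp add: coords_def)+
    have q1: "pairing (B $ 1 $ 1) (B $ 1 $ 2) (B $ 2 $ 2) (B $ 3 $ 3) (B $ 3 $ 4) (B $ 4 $ 4)
        + 2 * (B $ 1 $ 3 * B $ 2 $ 4 + (B $ 1 $ 4)\<^sup>2) = 0"
      using q by (simp add: qform_def pairing_def algebra_simps)
    have q2: "pairing (B $ 1 $ 1) (B $ 1 $ 3) (B $ 3 $ 3) (B $ 2 $ 2) (B $ 2 $ 4) (B $ 4 $ 4)
        + 2 * (B $ 1 $ 2 * B $ 3 $ 4 + (B $ 1 $ 4)\<^sup>2) = 0"
      using q by (simp add: qform_def pairing_def algebra_simps)
    show ?thesis
      using root_of_Q_distinguished[OF V d] e q1 q2
      unfolding tuple_of_def swapped_tuple_of_def rooted_def ends_box_def by blast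
  qed
  define S1 S2 where "S1 = {B \<in> S. tuple_of B \<in> rooted n}" and "S2 = {B \<in> S. swapped_tuple_of B \<in> rooted n}"
  have "inj_on tuple_of S1" "inj_on swapped_tuple_of S2"
    by (rule inj_on_subset[OF inj_tuple_of(1)] inj_on_subset[OF inj_tuple_of(2)], force simp: S1_def S2_def S_def)+
  then have "card S1 \<le> card (rooted n)" "card S2 \<le> card (rooted n)"
    using fin by (auto intro!: card_inj_on_le simp: S1_def S2_def)
  moreover have "S = S1 \<union> S2" using cover by (auto simp: S1_def S2_def)
  ultimately have "card S \<le> 2 * card (rooted n)" using card_Un_le[of S1 S2] by simp
  then show ?thesis by (simp add: N_q_dist_def S_def n_def)
qed

theorem theorem4p1:
  fixes \<delta> c1 c2 \<epsilon> :: real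
  assumes "0 < \<delta>" and "\<delta> < 1 / 100" and "0 < c1" and "0 < c2" and "0 < \<epsilon>"
  shows "\<exists>C X0. \<forall>X \<ge> X0. \<forall>Y. admissible \<delta> c1 c2 X Y \<longrightarrow>
    real (N_q_dist (coord_box Y)) \<le> C * X powr (209 / 30 + 137 / 45 * \<delta> + \<epsilon>)"
proof -
  \<comment> \<open>The value is \<open>41 / 6\<close>, so
    \<open>(1 + 2 * \<delta>) * \<theta> = 41 / 6 + 41 / 3 * \<delta>\<close>. Compared with the
    target, the excess \<open>478 / 45 * \<delta>\<close> stays below
    \<open>209 / 30 - 41 / 6 = 2 / 15\<close> for \<open>\<delta> < 1 / 100\<close>.\<close>
  define \<theta> :: real where "\<theta> = 20 / 3 + 1 / 6"
  obtain K where K: "K \<ge> 0" "\<And>n. n > 0 \<Longrightarrow> real (card (rooted n)) \<le> K * real n powr \<theta>"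
    using card_rooted_le[of "1 / 6"] unfolding \<theta>_def by auto
  show ?thesis
  proof (intro exI allI impI)
    fix X :: real and Y :: "4 \<Rightarrow> 4 \<Rightarrow> real"
    \<comment> \<open>This fixes the threshold \<open>X0\<close>; it ensures
      \<open>T \<ge> 1\<close>, so that \<open>n\<close> is positive.\<close>
    assume X: "max 1 (1 / c1) \<le> X" and Y: "admissible \<delta> c1 c2 X Y"
    define T where "T = c1 * X powr (1 + 2 * \<delta>)"
    have X1: "X \<ge> 1" "1 / c1 \<le> X" using X by auto
    have "1 \<le> c1 * X" using X1(2) assms(3) by (simp add: field_simps)
    also have "c1 * X \<le> T"
      using powr_mono[of 1 "1 + 2 * \<delta>" X] X1(1) assms(1,3) by (simp add: T_def)
    finally have T: "T \<ge> 1" .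
    define n where "n = nat \<lfloor>T\<rfloor>"
    have n: "n > 0" "real n \<le> T" using T by (auto simp: n_def)
    have "N_q_dist (coord_box Y) \<le> 2 * card (rooted n)"
      unfolding n_def using Y T by (intro N_q_dist_le) (auto simp: admissible_def T_def)
    then have "real (N_q_dist (coord_box Y)) \<le> 2 * real (card (rooted n))" by linarith
    also have "\<dots> \<le> 2 * (K * real n powr \<theta>)" using K(2)[OF n(1)] by simp
    also have "\<dots> \<le> 2 * (K * T powr \<theta>)"
      using n K(1) by (intro mult_left_mono powr_mono2) (auto simp: \<theta>_def)
    also have "T powr \<theta> = c1 powr \<theta> * X powr ((1 + 2 * \<delta>) * \<theta>)"
      unfolding T_def using assms(3) by (simp add: powr_mult powr_powr)
    also have "2 * (K * \<dots>) = 2 * K * c1 powr \<theta> * X powr ((1 + 2 * \<delta>) * \<theta>)" by simp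
    also have "\<dots> \<le> 2 * K * c1 powr \<theta> * X powr (209 / 30 + 137 / 45 * \<delta> + \<epsilon>)"
      using X1(1) K(1) assms(2,5) by (intro mult_left_mono powr_mono) (auto simp: \<theta>_def algebra_simps)
    finally show "real (N_q_dist (coord_box Y)) \<le>
      2 * K * c1 powr \<theta> * X powr (209 / 30 + 137 / 45 * \<delta> + \<epsilon>)" .
  qed
qed

end
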